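(* (i) Let $I = (\eta)$ be a principal ideal such that $r(\eta_a)\asymp \log$ or $\eta \asymp \widehat \eta$, and let $J$ be an arbitrary ideal. Then $J_{a^2} \supset I_{a^2}$ implies $J_a \supset I_a$. (ii) Let $I$ be a general ideal such that every $\mu \in \Sigma(I)$ is dominated termwise by some $\eta \in \Sigma(I)$ for which $r(\eta_a) \asymp \log$ or $\eta \asymp \widehat \eta$. Then for every ideal $J$, $J_{a^2} \supset I_{a^2}$ implies $J_a \supset I_a$.
   Context: $H$ is an infinite-dimensional separable complex Hilbert space and $B(H)$ is the algebra of bounded operators on it. $\text{c}_{\text{o}}^*$ is the set of nonnegative real sequences $\xi = (\xi_n)_{n\ge 1}$ that are nonincreasing and converge to $0$. For $m \in \mathbb N$, the ampliation $D_m\xi$ is the sequence in which each entry of $\xi$ is repeated $m$ times. A characteristic set is a positive cone $\Sigma \subset \text{c}_{\text{o}}^*$ (closed under sums and nonnegative scalar multiples) that is hereditary ($0\le\eta \le \xi\in\Sigma$, $\eta\in \text{c}_{\text{o}}^*$, implies $\eta \in \Sigma$) and invariant under all $D_m$. By Calkin's theorem, $I \mapsto \Sigma(I) := \{s(X) \mid X \in I\}$, with $s(X)$ the sequence of $s$-numbers (singular values) of $X$ in decreasing order with multiplicity, completed by zeros if $X$ has finite rank, is an order-preserving bijection from the (proper, two-sided) ideals of $B(H)$ onto the characteristic sets; "ideal" means such an ideal. For $\xi\in \text{c}_{\text{o}}^*$, $(\xi_a)_n := \frac1n\sum_{j=1}^n \xi_j$ and $\xi_{a^2} := (\xi_a)_a$.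 The arithmetic mean ideal $I_a$ of an ideal $I$ is the ideal with $\Sigma(I_a) = \{\xi \in \text{c}_{\text{o}}^* \mid \xi = O(\eta_a) \text{ for some } \eta\in\Sigma(I)\}$, and $I_{a^2} := (I_a)_a$. A principal ideal is an ideal $(\xi)$ with $\xi \in \text{c}_{\text{o}}^*$ and $\Sigma((\xi)) = \{\eta\in\text{c}_{\text{o}}^* \mid \eta = O(D_m\xi)\text{ for some } m \in \mathbb N\}$ (the ideal generated by the diagonal operator with entries $\xi_n$). For $\xi \in \text{c}_{\text{o}}^*$ with all $\xi_n>0$, the ratio of regularity is $r(\xi) := \xi_a/\xi$ (termwise). For $0\neq\eta\in\text{c}_{\text{o}}^*$, $r(\eta_a) = \eta_{a^2}/\eta_a$ is always defined. $r(\eta_a)\asymp\log$ means that $\alpha\log n\le r(\eta_a)_n\le\beta\log n$ for some $\alpha,\beta>0$ and all $n\ge 2$. For two sequences $\xi,\zeta$, $\xi\asymp\zeta$ means $\alpha\zeta_n\le\xi_n\le\beta\zeta_n$ for some $\alpha,\beta>0$ and all $n$. For a non-summable $\xi\in\text{c}_{\text{o}}^*$, $\widehat\xi$ is the sequence $(\widehat\xi)_n := (\xi_a)_{\nu(\xi)_n}$, where $\nu(\xi)_n := \min\{k\in\mathbb N \mid \sum_{i=1}^k\xi_i\ge n\xi_1\}$; the condition $\eta\asymp\widehat\eta$ presupposes that $\eta$ is not summable. *)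

theory Defs
  imports "HOL-Analysis.Analysis" "HOL-Library.Landau_Symbols" "HOL-Algebra.Ideal"
begin

section \<open>Complex Hilbert spaces and their bounded operators\<close>

text \<open>
  The real structure (\<open>scaleR\<close>, \<open>norm\<close>, completeness) comes from \<^class>\<open>banach\<close>; the axioms tie it to
  the complex one. The inner product is linear in its first argument.
\<close>

class complex_hilbert = banach +
  fixes scaleC :: "complex \<Rightarrow> 'a \<Rightarrow> 'a"
    and cinner :: "'a \<Rightarrow> 'a \<Rightarrow> complex"
  assumes scaleC_add_right: "scaleC c (x + y) = scaleC c x + scaleC c y"
    and scaleC_add_left: "scaleC (c + d) x = scaleC c x + scaleC d x"
    and scaleC_scaleC: "scaleC c (scaleC d x) = scaleC (c * d) x"
    and scaleC_one: "scaleC 1 x = x"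
    and scaleC_of_real: "scaleC (complex_of_real r) x = scaleR r x"
    and cinner_commute: "cinner x y = cnj (cinner y x)"
    and cinner_add_left: "cinner (x + y) z = cinner x z + cinner y z"
    and cinner_scaleC_left: "cinner (scaleC c x) y = c * cinner x y"
    and norm_cinner: "cinner x x = complex_of_real ((norm x)\<^sup>2)"

global_interpretation complex_vector: vector_space "scaleC :: complex \<Rightarrow> 'a \<Rightarrow> 'a::complex_hilbert"
  by unfold_locales (simp_all add: scaleC_add_right scaleC_add_left scaleC_scaleC scaleC_one)

definition infinite_dimensional :: "'h::complex_hilbert itself \<Rightarrow> bool" where
  "infinite_dimensional _ \<longleftrightarrow>
     \<not> (\<exists>B::'h set. finite B \<and> complex_vector.span B = UNIV)"

text \<open>
  \<^typ>\<open>'h \<Rightarrow>\<^sub>L 'h\<close> consists of the bounded \<^emph>\<open>real\<close>-linear maps; \<open>B(H)\<close> is the subset of the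
  complex-linear ones.
\<close>

definition bounded_operators :: "('h::complex_hilbert \<Rightarrow>\<^sub>L 'h) set" where
  "bounded_operators = {A :: 'h \<Rightarrow>\<^sub>L 'h. \<forall>c x. A (scaleC c x) = scaleC c (A x)}"

definition operator_ring :: "('h::complex_hilbert \<Rightarrow>\<^sub>L 'h) ring" where
  "operator_ring = \<lparr>carrier = bounded_operators, mult = (o\<^sub>L), one = id_blinfun,
                    zero = 0, add = (+)\<rparr>"

lemma ring_operator_ring: "ring (operator_ring :: ('h::complex_hilbert \<Rightarrow>\<^sub>L 'h) ring)"
proof -
  have neg: "(- A) \<in> bounded_operators" if "A \<in> bounded_operators" for A :: "'h \<Rightarrow>\<^sub>L 'h"
    using that
    by (simp add: bounded_operators_def uminus_blinfun.rep_eq complex_vector.scale_minus_right)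
  show ?thesis
  proof (rule ringI)
    show "abelian_group (operator_ring :: ('h \<Rightarrow>\<^sub>L 'h) ring)"
    proof (rule abelian_groupI)
      fix A :: "'h \<Rightarrow>\<^sub>L 'h"
      assume "A \<in> carrier operator_ring"
      then show "\<exists>B\<in>carrier operator_ring. B \<oplus>\<^bsub>operator_ring\<^esub> A = \<zero>\<^bsub>operator_ring\<^esub>"
        using neg by (intro bexI[of _ "- A"]) (simp_all add: operator_ring_def)
    qed (simp_all add: operator_ring_def bounded_operators_def blinfun.add_left scaleC_add_right
           add.assoc add.commute complex_vector.scale_zero_right)
    show "monoid (operator_ring :: ('h \<Rightarrow>\<^sub>L 'h) ring)"
      by (rule monoidI)
        (simp_all add: operator_ring_def bounded_operators_def blinfun_eqI)
  qed (simp_all add: operator_ring_def blinfun_eqI blinfun.add_left blinfun.add_right)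
qed

text \<open>Complex scalar multiples need no separate closure condition, since \<open>c\<cdot>id \<in> B(H)\<close>.\<close>

definition op_ideal :: "('h::complex_hilbert \<Rightarrow>\<^sub>L 'h) set \<Rightarrow> bool" where
  "op_ideal I \<longleftrightarrow> ideal I operator_ring \<and> I \<noteq> bounded_operators"

definition hilbert_adjoint :: "('h::complex_hilbert \<Rightarrow>\<^sub>L 'h) \<Rightarrow> ('h \<Rightarrow>\<^sub>L 'h)" where
  "hilbert_adjoint X = (THE Y :: 'h \<Rightarrow>\<^sub>L 'h. \<forall>x y. cinner (Y x) y = cinner x (X y))"

definition compact_operator :: "('h::complex_hilbert \<Rightarrow>\<^sub>L 'h) \<Rightarrow> bool" where
  "compact_operator X \<longleftrightarrow> X \<in> bounded_operators \<and> compact (closure (X ` cball 0 1))"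


section \<open>Sequences\<close>

text \<open>
  Sequences are indexed from 0: the entry \<open>\<xi>\<^sub>n\<close> of a sequence \<open>(\<xi>\<^sub>n)\<close>, \<open>n \<ge> 1\<close>, is \<open>\<xi> (n - 1)\<close>.
  An estimate \<open>\<xi> = O(\<eta>)\<close> is required at every index and not just eventually, hence the filter
  \<^term>\<open>principal UNIV\<close> in \<open>\<xi> \<in> O[principal UNIV](\<eta>)\<close>.
  The two versions differ for finitely supported sequences.
\<close>

definition c0star :: "(nat \<Rightarrow> real) set" where
  "c0star = {\<xi>. decseq \<xi> \<and> (\<forall>n. 0 \<le> \<xi> n) \<and> \<xi> \<longlonglongrightarrow> 0}"

definition ampliation :: "nat \<Rightarrow> (nat \<Rightarrow> real) \<Rightarrow> nat \<Rightarrow> real" where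
  "ampliation m \<xi> n = \<xi> (n div m)"

definition am :: "(nat \<Rightarrow> real) \<Rightarrow> nat \<Rightarrow> real" where
  "am \<xi> n = (\<Sum>j\<le>n. \<xi> j) / real (n + 1)"

definition regularity_ratio :: "(nat \<Rightarrow> real) \<Rightarrow> nat \<Rightarrow> real" where
  "regularity_ratio \<xi> n = am \<xi> n / \<xi> n"

definition asymp_seq :: "(nat \<Rightarrow> real) \<Rightarrow> (nat \<Rightarrow> real) \<Rightarrow> bool" where
  "asymp_seq \<xi> \<zeta> \<longleftrightarrow>
     (\<exists>\<alpha>>0. \<exists>\<beta>>0. \<forall>n. \<alpha> * \<zeta> n \<le> \<xi> n \<and> \<xi> n \<le> \<beta> * \<zeta> n)"

text \<open>\<open>r(\<eta>\<^sub>a) \<asymp> log\<close>: the index \<open>n \<ge> 1\<close> below stands for the position \<open>n + 1 \<ge> 2\<close>.\<close>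

definition ratio_asymp_log :: "(nat \<Rightarrow> real) \<Rightarrow> bool" where
  "ratio_asymp_log \<eta> \<longleftrightarrow> \<eta> \<noteq> (\<lambda>_. 0) \<and>
     (\<exists>\<alpha>>0. \<exists>\<beta>>0. \<forall>n\<ge>1. \<alpha> * ln (real (n + 1)) \<le> regularity_ratio (am \<eta>) n \<and>
                        regularity_ratio (am \<eta>) n \<le> \<beta> * ln (real (n + 1)))"

text \<open>
  \<open>nu \<xi> n\<close> takes and returns positions counted from 1; \<^term>\<open>\<Sum>i<k. \<xi> i\<close> is the sum of the first
  \<open>k\<close> entries. The minimum exists for \<open>\<xi> \<in> c0star\<close> not summable.
\<close>

definition nu :: "(nat \<Rightarrow> real) \<Rightarrow> nat \<Rightarrow> nat" where
  "nu \<xi> n = (LEAST k. 1 \<le> k \<and> (\<Sum>i<k. \<xi> i) \<ge> real n * \<xi> 0)"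

definition hat :: "(nat \<Rightarrow> real) \<Rightarrow> nat \<Rightarrow> real" where
  "hat \<xi> n = am \<xi> (nu \<xi> (n + 1) - 1)"

definition asymp_hat :: "(nat \<Rightarrow> real) \<Rightarrow> bool" where
  "asymp_hat \<eta> \<longleftrightarrow> \<not> summable \<eta> \<and> asymp_seq \<eta> (hat \<eta>)"


section \<open>Singular numbers and arithmetic mean ideals\<close>

text \<open>
  \<open>snumbers X \<sigma>\<close> says that \<open>\<sigma>\<close> is the sequence \<open>s(X)\<close> of the compact operator \<open>X\<close>: it decreases to 0 and
  every \<open>t > 0\<close> occurs in it as often as the multiplicity of \<open>t\<close> as a singular value, which is the
  (finite) dimension of the kernel of \<open>X\<^sup>*X - t\<^sup>2\<close>. The entries that remain are zeros.
  Such a \<open>\<sigma>\<close> exists for every compact \<open>X\<close> by the spectral theorem. Operators in proper ideals of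
  \<open>B(H)\<close> are compact.
\<close>

definition snumbers :: "('h::complex_hilbert \<Rightarrow>\<^sub>L 'h) \<Rightarrow> (nat \<Rightarrow> real) \<Rightarrow> bool" where
  "snumbers X \<sigma> \<longleftrightarrow> compact_operator X \<and> \<sigma> \<in> c0star \<and>
     (\<forall>t>0. card {n. \<sigma> n = t} =
        complex_vector.dim {x. hilbert_adjoint X (X x) = scaleC (complex_of_real (t\<^sup>2)) x})"

lemma c0star_eqI:
  assumes s: "\<sigma> \<in> c0star" and u: "\<tau> \<in> c0star"
    and eq: "\<And>t. 0 < t \<Longrightarrow> card {n. \<sigma> n = t} = card {n. \<tau> n = t}"
  shows "\<sigma> = \<tau>"
proof -
  have fin: "finite {n. t \<le> \<rho> n}" if "\<rho> \<in> c0star" "0 < t" for \<rho> :: "nat \<Rightarrow> real" and t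
  proof -
    have "eventually (\<lambda>n. \<rho> n < t) sequentially"
      using that order_tendstoD(2)[of \<rho> 0 sequentially t] by (simp add: c0star_def)
    then obtain N where N: "\<And>n. n \<ge> N \<Longrightarrow> \<rho> n < t"
      unfolding eventually_sequentially by blast
    have "{n. t \<le> \<rho> n} \<subseteq> {..<N}"
    proof
      fix n assume "n \<in> {n. t \<le> \<rho> n}"
      then show "n \<in> {..<N}" using N[of n] by (cases "n < N") auto
    qed
    then show ?thesis
      using finite_subset by blast
  qed
  have card: "card {n. t \<le> \<rho> n} = (\<Sum>v\<in>V. card {n. \<rho> n = v})"
    if "\<rho> \<in> c0star" "0 < t" "finite V" "\<rho> ` {n. t \<le> \<rho> n} \<subseteq> V" "\<And>v. v \<in> V \<Longrightarrow> t \<le> v"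
    for \<rho> :: "nat \<Rightarrow> real" and t V
  proof -
    have "{n. t \<le> \<rho> n} = (\<Union>v\<in>V. {n. \<rho> n = v})"
      using that(4,5) by auto
    moreover have "finite {n. \<rho> n = v}" if "v \<in> V" for v
      by (rule finite_subset[OF _ fin[OF \<open>\<rho> \<in> c0star\<close> \<open>0 < t\<close>]])
        (use \<open>\<And>v. v \<in> V \<Longrightarrow> t \<le> v\<close>[OF that] in auto)
    ultimately show ?thesis
      using \<open>finite V\<close> card_UN_disjoint[of V "\<lambda>v. {n. \<rho> n = v}"] by auto
  qed
  have seg: "t \<le> \<rho> n \<longleftrightarrow> n < card {n. t \<le> \<rho> n}" if "\<rho> \<in> c0star" "0 < t"
    for \<rho> :: "nat \<Rightarrow> real" and t n
  proof
    assume "t \<le> \<rho> n"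
    moreover have "\<rho> n \<le> \<rho> m" if "m \<le> n" for m
      using \<open>\<rho> \<in> c0star\<close> that by (simp add: c0star_def decseq_def)
    ultimately have "{..n} \<subseteq> {n. t \<le> \<rho> n}"
      using order_trans by blast
    then have "card {..n} \<le> card {n. t \<le> \<rho> n}"
      using fin[OF that] card_mono by blast
    then show "n < card {n. t \<le> \<rho> n}" by simp
  next
    assume *: "n < card {n. t \<le> \<rho> n}"
    show "t \<le> \<rho> n"
    proof (rule ccontr)
      assume **: "\<not> t \<le> \<rho> n"
      have "m < n" if "t \<le> \<rho> m" for m
      proof (rule ccontr)
        assume "\<not> m < n"
        then have "\<rho> m \<le> \<rho> n"
          using \<open>\<rho> \<in> c0star\<close> by (auto simp: c0star_def decseq_def)
        then show False using that ** by linarith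
      qed
      then have "{n. t \<le> \<rho> n} \<subseteq> {..<n}" by auto
      then have "card {n. t \<le> \<rho> n} \<le> n"
        using card_mono[of "{..<n}" "{n. t \<le> \<rho> n}"] by simp
      then show False using * by simp
    qed
  qed
  have le: "t \<le> \<sigma> n \<longleftrightarrow> t \<le> \<tau> n" if "0 < t" for t n
  proof -
    define V where "V = \<sigma> ` {n. t \<le> \<sigma> n} \<union> \<tau> ` {n. t \<le> \<tau> n}"
    have V: "finite V" "\<And>v. v \<in> V \<Longrightarrow> t \<le> v"
      using fin[OF s that] fin[OF u that] by (auto simp: V_def)
    have "card {n. t \<le> \<sigma> n} = (\<Sum>v\<in>V. card {n. \<sigma> n = v})"
      by (rule card[OF s that V(1) _ V(2)]) (auto simp: V_def)
    also have "\<dots> = (\<Sum>v\<in>V. card {n. \<tau> n = v})"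
    proof (rule sum.cong[OF refl])
      fix v assume "v \<in> V"
      then have "0 < v" using V(2)[of v] that by linarith
      then show "card {n. \<sigma> n = v} = card {n. \<tau> n = v}" by (rule eq)
    qed
    also have "\<dots> = card {n. t \<le> \<tau> n}"
      by (rule card[OF u that V(1) _ V(2), symmetric]) (auto simp: V_def)
    finally show ?thesis using seg[OF s that, of n] seg[OF u that, of n] by metis
  qed
  show ?thesis
  proof
    fix n
    have "0 \<le> \<sigma> n" "0 \<le> \<tau> n" using s u by (auto simp: c0star_def)
    then show "\<sigma> n = \<tau> n"
      using le[of "\<sigma> n" n] le[of "\<tau> n" n] by linarith
  qed
qed

lemma snumbers_unique: "snumbers X \<sigma> \<Longrightarrow> snumbers X \<tau> \<Longrightarrow> \<sigma> = \<tau>"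
  by (rule c0star_eqI) (auto simp: snumbers_def)

definition Sigma_set :: "('h::complex_hilbert \<Rightarrow>\<^sub>L 'h) set \<Rightarrow> (nat \<Rightarrow> real) set" where
  "Sigma_set I = {\<sigma>. \<exists>X\<in>I. snumbers X \<sigma>}"

text \<open>The inverse of Calkin's bijection \<^const>\<open>Sigma_set\<close>: the ideal with a given characteristic set.\<close>

definition calkin_ideal :: "(nat \<Rightarrow> real) set \<Rightarrow> ('h::complex_hilbert \<Rightarrow>\<^sub>L 'h) set" where
  "calkin_ideal S = {X. \<exists>\<sigma>\<in>S. snumbers X \<sigma>}"

definition am_ideal :: "('h::complex_hilbert \<Rightarrow>\<^sub>L 'h) set \<Rightarrow> ('h \<Rightarrow>\<^sub>L 'h) set" where
  "am_ideal I = calkin_ideal {\<xi> \<in> c0star. \<exists>\<eta>\<in>Sigma_set I. \<xi> \<in> O[principal UNIV](am \<eta>)}"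

text \<open>\<open>I = (\<xi>)\<close>\<close>

definition principal_ideal_of :: "('h::complex_hilbert \<Rightarrow>\<^sub>L 'h) set \<Rightarrow> (nat \<Rightarrow> real) \<Rightarrow> bool" where
  "principal_ideal_of I \<xi> \<longleftrightarrow> op_ideal I \<and> \<xi> \<in> c0star \<and>
     Sigma_set I = {\<eta> \<in> c0star. \<exists>m\<ge>1. \<eta> \<in> O[principal UNIV](ampliation m \<xi>)}"

end

theory Submission
  imports Defs
begin

text \<open>
  Through singular numbers the theorem becomes a statement about two sequences. Every
  \<open>\<sigma> \<in> c0star\<close> is the singular number sequence of a diagonal operator, so \<^const>\<open>Sigma_set\<close> of an
  arithmetic mean ideal is what its definition prescribes, and the inclusion of the second order
  ideals says: each \<open>\<eta> \<in> \<Sigma>(I)\<close> admits some \<open>\<zeta> \<in> \<Sigma>(J)\<close> with \<open>\<eta>\<^sub>a\<^sub>a = O(\<zeta>\<^sub>a\<^sub>a)\<close>. Since every sequence in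
  \<open>\<Sigma>(I)\<close> is bounded, in the mean, by an \<open>\<eta> \<in> \<Sigma>(I)\<close> that satisfies one of the two growth conditions,
  it suffices to cancel one arithmetic mean for such \<open>\<eta>\<close>: \<open>\<eta>\<^sub>a\<^sub>a = O(\<zeta>\<^sub>a\<^sub>a)\<close> implies \<open>\<eta>\<^sub>a = O(\<zeta>\<^sub>a)\<close>.

  If \<open>r(\<eta>\<^sub>a) \<asymp> log\<close>, this is because taking the mean of \<open>\<zeta>\<^sub>a\<close> can gain at most a logarithm:
  \<open>\<zeta>\<^sub>a\<^sub>a(n) \<le> H\<^sub>n \<zeta>\<^sub>a(n)\<close> with the harmonic number \<open>H\<^sub>n\<close>, and \<open>\<eta>\<^sub>a\<^sub>a\<close> does gain one.

  If \<open>\<eta> \<asymp> hat \<eta>\<close>, write \<open>E(N)\<close> for the sum of the first \<open>N\<close> entries of \<open>\<eta>\<close>. The condition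
  bounds \<open>\<eta>(n)\<close> by a multiple of the mean \<open>E(N)/N\<close> for every \<open>N\<close> with \<open>E(N) < n \<eta>(1)\<close>; such \<open>N\<close> can be
  much larger than \<open>n\<close> because \<open>\<eta>\<close> tends to zero (\<open>le_mean_if_le_hat\<close>). Two consequences give the
  result. First, \<open>\<eta>\<close> is regular, \<open>\<eta>\<^sub>a = O(\<eta>)\<close> (\<open>regular_if_le_hat\<close>): if \<open>\<eta>(n)\<close> is small compared with
  \<open>\<eta>\<^sub>a(n)\<close>, the partial sums at most double on a long interval after \<open>n\<close>, so the means at its end are
  small, and the condition makes \<open>\<eta>(p)\<close> small already at a place \<open>p\<close> of order \<open>E(n)\<close>. Only a small part
  of \<open>E(n)\<close> is collected up to \<open>p\<close>, because \<open>\<eta>\<^sub>a\<close> tends to zero, and little can be added after \<open>p\<close>.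
  Second, \<open>\<eta> = O(\<zeta>\<^sub>a)\<close> (\<open>bigo_am_if_le_hat\<close>). With
  \<open>x = \<zeta>\<^sub>a(n)\<close>, the values of \<open>\<zeta>\<^sub>a\<close> are at most \<open>x\<close> after \<open>n\<close>, and before \<open>n\<close> their sum is at most of
  order \<open>n \<surd>x\<close>; so at \<open>m\<close> of order \<open>n / \<surd>x\<close> the hypothesis yields \<open>E(m) = O(m x)\<close>. Either
  \<open>E(m) < n \<eta>(1)\<close>, and the condition on \<open>\<eta>\<close> bounds \<open>\<eta>(n)\<close> by a multiple of \<open>E(m)/m\<close>, thus of \<open>x\<close>;
  or \<open>n \<eta>(1) = O(m x)\<close>, which is \<open>O(n \<surd>x)\<close>, and then \<open>x\<close> is bounded away from zero.
\<close>


section \<open>Arithmetic means of sequences decreasing to zero\<close>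

lemma c0starD:
  assumes "\<xi> \<in> c0star"
  shows "decseq \<xi>" "0 \<le> \<xi> n" "\<xi> \<longlonglongrightarrow> 0"
  using assms by (auto simp: c0star_def)

lemma c0star_antimono: "\<xi> \<in> c0star \<Longrightarrow> m \<le> n \<Longrightarrow> \<xi> n \<le> \<xi> m"
  by (auto simp: c0star_def decseq_def)

lemma bigo_everywhere_iff:
  fixes f g :: "nat \<Rightarrow> real"
  assumes "\<And>n. 0 \<le> f n" "\<And>n. 0 \<le> g n"
  shows "f \<in> O[principal UNIV](g) \<longleftrightarrow> (\<exists>C>0. \<forall>n. f n \<le> C * g n)"
  using assms by (simp add: bigo_def eventually_principal)

lemma bigo_everywhere_trans:
  fixes f g h :: "nat \<Rightarrow> real"
  assumes "f \<in> O[principal UNIV](g)" "g \<in> O[principal UNIV](h)"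
  shows "f \<in> O[principal UNIV](h)"
  using landau_o.big_trans[OF assms] .

text \<open>
  Finitely many exceptions are absorbed into the constant, which needs \<open>g\<close> to vanish nowhere.
\<close>
lemma bigo_everywhere_if_eventually:
  fixes f g :: "nat \<Rightarrow> real"
  assumes ev: "f \<in> O(g)" and g: "\<And>n. 0 < g n"
  shows "f \<in> O[principal UNIV](g)"
proof -
  obtain c N where c: "\<And>n. n \<ge> N \<Longrightarrow> norm (f n) \<le> c * norm (g n)"
    using landau_o.bigE[OF ev] unfolding eventually_sequentially by metis
  define K where "K = \<bar>c\<bar> + (\<Sum>n<N. \<bar>f n\<bar> / g n)"
  have "norm (f n) \<le> K * norm (g n)" for n
  proof (cases "n < N")
    case True
    have "\<bar>f n\<bar> / g n \<le> (\<Sum>n<N. \<bar>f n\<bar> / g n)"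
      using True g by (intro member_le_sum) (auto simp: less_imp_le)
    then have "\<bar>f n\<bar> / g n \<le> K" by (simp add: K_def)
    then show ?thesis using g[of n] by (simp add: field_simps)
  next
    case False
    have "0 \<le> (\<Sum>n<N. \<bar>f n\<bar> / g n)" using g by (intro sum_nonneg) (auto simp: less_imp_le)
    then have "c \<le> K" unfolding K_def by linarith
    then have "c * norm (g n) \<le> K * norm (g n)" by (intro mult_right_mono) auto
    then show ?thesis using c[of n] False by linarith
  qed
  then show ?thesis by (intro bigoI[where c = K]) (simp add: eventually_principal)
qed

text \<open>Positions count from 1 and indices from 0: \<open>am \<xi> n\<close> is the mean of the first \<open>Suc n\<close> entries.\<close>

lemma am_eq: "am \<xi> n = (\<Sum>i<Suc n. \<xi> i) / real (Suc n)"
  by (simp add: am_def lessThan_Suc_atMost)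

lemma Suc_mult_am: "real (Suc n) * am \<xi> n = (\<Sum>i<Suc n. \<xi> i)"
  unfolding am_eq by (simp del: of_nat_Suc)

lemma psum_mono:
  fixes \<xi> :: "nat \<Rightarrow> real"
  assumes "\<xi> \<in> c0star" "m \<le> n"
  shows "(\<Sum>i<m. \<xi> i) \<le> (\<Sum>i<n. \<xi> i)"
  using assms c0starD(2)[OF assms(1)] by (intro sum_mono2) auto

text \<open>
  This trade-off between the mass before \<open>n\<close> and the height at \<open>n\<close> is used both forwards, to bound the
  growth of partial sums after \<open>n\<close>, and backwards, to see where most of a partial sum is collected.
\<close>
lemma psum_le_add:
  assumes x: "\<xi> \<in> c0star"
  shows "(\<Sum>i<N. \<xi> i) \<le> (\<Sum>i<n. \<xi> i) + real N * \<xi> n"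
proof (cases "N \<le> n")
  case True
  have "0 \<le> real N * \<xi> n" using c0starD(2)[OF x] by simp
  then show ?thesis using psum_mono[OF x True] by linarith
next
  case False
  have "(\<Sum>i<N. \<xi> i) = (\<Sum>i<n. \<xi> i) + (\<Sum>i=n..<N. \<xi> i)"
    using False by (metis lessThan_atLeast0 le_cases sum.atLeastLessThan_concat zero_le)
  also have "(\<Sum>i=n..<N. \<xi> i) \<le> (\<Sum>i=n..<N. \<xi> n)"
    using c0star_antimono[OF x] by (intro sum_mono) auto
  also have "\<dots> \<le> real N * \<xi> n"
    using c0starD(2)[OF x, of n] by (auto intro!: mult_right_mono)
  finally show ?thesis by simp
qed

lemma am_nonneg: "(\<And>n. 0 \<le> \<xi> n) \<Longrightarrow> 0 \<le> am \<xi> n"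
  by (auto simp: am_def intro!: divide_nonneg_nonneg sum_nonneg)

lemma am_pos: "\<xi> \<in> c0star \<Longrightarrow> 0 < \<xi> 0 \<Longrightarrow> 0 < am \<xi> n"
  using psum_mono[of \<xi> 1 "Suc n"] unfolding am_eq
  by (intro divide_pos_pos) auto

lemma am_ge: "\<xi> \<in> c0star \<Longrightarrow> \<xi> n \<le> am \<xi> n"
proof -
  assume x: "\<xi> \<in> c0star"
  have "real (Suc n) * \<xi> n = (\<Sum>i<Suc n. \<xi> n)" by simp
  also have "\<dots> \<le> (\<Sum>i<Suc n. \<xi> i)"
    using c0star_antimono[OF x] by (intro sum_mono) auto
  finally show ?thesis
    unfolding am_eq by (simp add: field_simps del: sum.lessThan_Suc)
qed

lemma am_le_scaled:
  assumes "\<And>n. \<xi> n \<le> c * \<zeta> n"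
  shows "am \<xi> n \<le> c * am \<zeta> n"
proof -
  have "(\<Sum>j\<le>n. \<xi> j) \<le> (\<Sum>j\<le>n. c * \<zeta> j)" using assms by (intro sum_mono) auto
  then show ?thesis unfolding am_def
    by (simp add: divide_right_mono sum_distrib_left[symmetric])
qed

lemma decseq_am:
  assumes x: "\<xi> \<in> c0star"
  shows "decseq (am \<xi>)"
proof (rule decseq_SucI)
  fix n
  have "real (Suc (Suc n)) * am \<xi> (Suc n) = real (Suc n) * am \<xi> n + \<xi> (Suc n)"
    by (simp only: Suc_mult_am) simp
  also have "\<xi> (Suc n) \<le> am \<xi> n"
    using am_ge[OF x, of n] c0star_antimono[OF x, of n "Suc n"] by simp
  finally have "real (Suc (Suc n)) * am \<xi> (Suc n) \<le> real (Suc (Suc n)) * am \<xi> n"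
    by (simp add: algebra_simps)
  then show "am \<xi> (Suc n) \<le> am \<xi> n" by (simp add: mult_le_cancel_left)
qed

lemma am_tendsto_0:
  assumes x: "\<xi> \<in> c0star"
  shows "am \<xi> \<longlonglongrightarrow> 0"
proof (rule order_tendstoI)
  fix a :: real assume "a < 0"
  then show "\<forall>\<^sub>F n in sequentially. a < am \<xi> n"
    using am_nonneg[of \<xi>] c0starD(2)[OF x] by (intro always_eventually allI) (meson less_le_trans)
next
  fix a :: real assume a: "0 < a"
  obtain n0 where n0: "\<xi> n0 < a / 2"
    using order_tendstoD(2)[OF c0starD(3)[OF x], of "a/2"] a
    unfolding eventually_sequentially by auto
  have "(\<lambda>n. (\<Sum>i<n0. \<xi> i) / real (Suc n)) \<longlonglongrightarrow> 0"
    by (rule LIMSEQ_Suc) (simp add: lim_const_over_n)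
  then have "\<forall>\<^sub>F n in sequentially. (\<Sum>i<n0. \<xi> i) / real (Suc n) < a / 2"
    using a by (intro order_tendstoD(2)) auto
  then show "\<forall>\<^sub>F n in sequentially. am \<xi> n < a"
  proof eventually_elim
    case (elim n)
    have "am \<xi> n \<le> ((\<Sum>i<n0. \<xi> i) + real (Suc n) * \<xi> n0) / real (Suc n)"
      unfolding am_eq using psum_le_add[OF x] by (rule divide_right_mono) simp
    also have "\<dots> = (\<Sum>i<n0. \<xi> i) / real (Suc n) + \<xi> n0"
      by (simp add: add_divide_distrib del: of_nat_Suc)
    finally show ?case using elim n0 by linarith
  qed
qed

lemma am_in_c0star: "\<xi> \<in> c0star \<Longrightarrow> am \<xi> \<in> c0star"
  using decseq_am am_tendsto_0 am_nonneg[of \<xi>] by (auto simp: c0star_def)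

lemma c0star_pos_if_nonzero: "\<xi> \<in> c0star \<Longrightarrow> \<xi> \<noteq> (\<lambda>_. 0) \<Longrightarrow> 0 < \<xi> 0"
proof (rule ccontr)
  assume x: "\<xi> \<in> c0star" and nz: "\<xi> \<noteq> (\<lambda>_. 0)" and "\<not> 0 < \<xi> 0"
  then have "\<xi> n = 0" for n using c0star_antimono[OF x, of 0 n] c0starD(2)[OF x, of n] by simp
  then show False using nz by auto
qed

text \<open>
  The first \<open>k\<close> entries of \<open>D\<^sub>m \<xi>\<close> are among its first \<open>k m\<close> ones, which are \<open>m\<close> copies of the first
  \<open>k\<close> entries of \<open>\<xi>\<close>. Ampliations therefore disappear under arithmetic means.
\<close>
lemma am_ampliation_le:
  assumes x: "\<xi> \<in> c0star" and m: "1 \<le> m"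
  shows "am (ampliation m \<xi>) n \<le> real m * am \<xi> n"
proof -
  let ?k = "Suc n"
  have "?k * 1 \<le> ?k * m" using m by (rule mult_le_mono2)
  then have "?k \<le> ?k * m" by simp
  then have "(\<Sum>i<?k. ampliation m \<xi> i) \<le> (\<Sum>i<?k * m. ampliation m \<xi> i)"
    using c0starD(2)[OF x] by (intro sum_mono2) (auto simp: ampliation_def)
  also have "\<dots> = (\<Sum>j<?k. \<Sum>i=j*m..<j*m+m. ampliation m \<xi> i)"
    by (rule sum.nat_group[symmetric])
  also have "\<dots> = (\<Sum>j<?k. real m * \<xi> j)"
  proof (rule sum.cong[OF refl])
    fix j
    have "(\<Sum>i=j*m..<j*m+m. ampliation m \<xi> i) = (\<Sum>i=j*m..<j*m+m. \<xi> j)"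
    proof (rule sum.cong[OF refl])
      fix i assume "i \<in> {j*m..<j*m+m}"
      then have "i div m = j" by (intro div_nat_eqI) (auto simp: mult.commute)
      then show "ampliation m \<xi> i = \<xi> j" by (simp add: ampliation_def)
    qed
    then show "(\<Sum>i=j*m..<j*m+m. ampliation m \<xi> i) = real m * \<xi> j" by simp
  qed
  finally have "(\<Sum>i<?k. ampliation m \<xi> i) \<le> real m * (\<Sum>i<?k. \<xi> i)"
    by (simp add: sum_distrib_left distrib_left)
  then show ?thesis unfolding am_eq
    by (simp add: divide_right_mono del: sum.lessThan_Suc of_nat_Suc)
qed


section \<open>Cancelling a mean under logarithmic growth\<close>

text \<open>
  In \<open>\<zeta>\<^sub>a(i) = S(i)/i\<close> each partial sum \<open>S(i)\<close>, \<open>i \<le> n\<close>, is replaced by \<open>S(n)\<close>.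
\<close>
lemma am_am_le_harm:
  assumes z: "\<zeta> \<in> c0star"
  shows "am (am \<zeta>) n \<le> harm (Suc n) * am \<zeta> n"
proof -
  have "am \<zeta> i \<le> (\<Sum>j<Suc n. \<zeta> j) * inverse (real (Suc i))" if "i < Suc n" for i
    unfolding am_eq divide_inverse
    using psum_mono[OF z, of "Suc i" "Suc n"] that by (intro mult_right_mono) auto
  then have "(\<Sum>i<Suc n. am \<zeta> i) \<le> (\<Sum>i<Suc n. (\<Sum>j<Suc n. \<zeta> j) * inverse (real (Suc i)))"
    by (intro sum_mono) auto
  also have "\<dots> = (\<Sum>j<Suc n. \<zeta> j) * harm (Suc n)"
    unfolding sum_distrib_left[symmetric] harm_altdef by simp
  finally have "(\<Sum>i<Suc n. am \<zeta> i) / real (Suc n) \<le> (\<Sum>j<Suc n. \<zeta> j) * harm (Suc n) / real (Suc n)"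
    by (rule divide_right_mono) simp
  then show ?thesis
    unfolding am_eq[of "am \<zeta>"] am_eq[of \<zeta> n] by (simp add: mult.commute del: sum.lessThan_Suc of_nat_Suc)
qed

lemma harm_le_ln:
  assumes "1 \<le> n"
  shows "harm (Suc n) \<le> 3 * ln (real (Suc n))"
proof -
  have "harm (Suc n) - ln (real (Suc n)) \<le> harm 1 - ln (real 1)"
    using euler_mascheroni_sequence_decreasing[of 1 "Suc n"] by simp
  then have 1: "harm (Suc n) \<le> ln (real (Suc n)) + (1::real)" by (simp add: harm_expand)
  have "1/2 \<le> ln (2::real)" using ln2_ge_two_thirds by simp
  also have "\<dots> \<le> ln (real (Suc n))" using assms by simp
  finally show ?thesis using 1 by linarith
qed

text \<open>
  The logarithm in the lower bound for \<open>r(\<eta>\<^sub>a)\<close> cancels the harmonic number of \<open>am_am_le_harm\<close>. At the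
  first position, where \<open>log\<close> vanishes, the means of both orders agree.
\<close>
lemma am_cancel_log:
  assumes e: "\<eta> \<in> c0star" and z: "\<zeta> \<in> c0star" and l: "ratio_asymp_log \<eta>"
    and aa: "am (am \<eta>) \<in> O[principal UNIV](am (am \<zeta>))"
  shows "am \<eta> \<in> O[principal UNIV](am \<zeta>)"
proof -
  note nn = am_nonneg[OF am_nonneg] am_nonneg c0starD(2)[OF e] c0starD(2)[OF z]
  obtain C where C: "C > 0" "\<And>n. am (am \<eta>) n \<le> C * am (am \<zeta>) n"
    using aa by (subst (asm) bigo_everywhere_iff) (auto intro: nn)
  obtain \<alpha> where \<alpha>: "\<alpha> > 0" "\<And>n. n \<ge> 1 \<Longrightarrow> \<alpha> * ln (real (n + 1)) \<le> regularity_ratio (am \<eta>) n"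
    using l unfolding ratio_asymp_log_def by blast
  have pos: "0 < am \<eta> n" for n
    using l am_pos[OF e c0star_pos_if_nonzero[OF e]] by (simp add: ratio_asymp_log_def)
  have "am \<eta> n \<le> (C + 3 * C / \<alpha>) * am \<zeta> n" for n
  proof (cases "n = 0")
    case True
    have "am \<eta> 0 \<le> C * am \<zeta> 0" using C(2)[of 0] by (simp add: am_def)
    also have "\<dots> \<le> (C + 3 * C / \<alpha>) * am \<zeta> 0"
      using C(1) \<alpha>(1) by (intro mult_right_mono am_nonneg nn) auto
    finally show ?thesis using True by simp
  next
    case False
    define L where "L = ln (real (Suc n))"
    have L: "L > 0" using False by (simp add: L_def)
    have "\<alpha> * L * am \<eta> n \<le> am (am \<eta>) n"
      using \<alpha>(2)[of n] False pos[of n] by (simp add: L_def regularity_ratio_def pos_le_divide_eq)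
    also have "\<dots> \<le> C * am (am \<zeta>) n" by (rule C)
    also have "\<dots> \<le> C * (harm (Suc n) * am \<zeta> n)"
      using C(1) am_am_le_harm[OF z] by (intro mult_left_mono) auto
    also have "\<dots> \<le> C * (3 * L * am \<zeta> n)"
      using C(1) harm_le_ln[of n] False unfolding L_def
      by (intro mult_left_mono mult_right_mono am_nonneg nn) auto
    finally have "L * (\<alpha> * am \<eta> n) \<le> L * (3 * C * am \<zeta> n)" by (simp add: ac_simps)
    then have "\<alpha> * am \<eta> n \<le> 3 * C * am \<zeta> n" using L by simp
    then have "am \<eta> n \<le> 3 * C / \<alpha> * am \<zeta> n" using \<alpha>(1) by (simp add: field_simps)
    also have "\<dots> \<le> (C + 3 * C / \<alpha>) * am \<zeta> n"
      using C(1) \<alpha>(1) by (intro mult_right_mono am_nonneg nn) auto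
    finally show ?thesis .
  qed
  moreover have "C + 3 * C / \<alpha> > 0" using C(1) \<alpha>(1) by (simp add: add_pos_pos)
  ultimately show ?thesis by (subst bigo_everywhere_iff) (auto intro: nn)
qed


section \<open>Cancelling a mean when the sequence is equivalent to its hat\<close>

text \<open>
  The strict inequality puts \<open>N\<close> below \<open>nu \<eta> (n + 1)\<close>, and means decrease. In this form the
  hypothesis can be used without computing \<^const>\<open>nu\<close>.
\<close>
lemma le_mean_if_le_hat:
  assumes e: "\<eta> \<in> c0star" and ns: "\<not> summable \<eta>" and \<beta>: "0 \<le> \<beta>" and h: "\<And>n. \<eta> n \<le> \<beta> * hat \<eta> n"
    and N: "0 < N" and lt: "(\<Sum>i<N. \<eta> i) < real (Suc n) * \<eta> 0"
  shows "\<eta> n \<le> \<beta> * ((\<Sum>i<N. \<eta> i) / real N)"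
proof -
  let ?P = "\<lambda>k. 1 \<le> k \<and> (\<Sum>i<k. \<eta> i) \<ge> real (n + 1) * \<eta> 0"
  have "\<exists>k. ?P k"
  proof (rule ccontr)
    assume no: "\<nexists>k. ?P k"
    have "(\<Sum>i<k. \<eta> i) \<le> real (n + 1) * \<eta> 0" for k
    proof (cases "k = 0")
      case True
      then show ?thesis using c0starD(2)[OF e, of 0] by simp
    next
      case False
      then have "1 \<le> k" by simp
      then show ?thesis using no by (meson linear)
    qed
    then have "summable \<eta>"
      using c0starD(2)[OF e] by (intro summableI_nonneg_bounded)
    then show False using ns by simp
  qed
  then have P: "?P (nu \<eta> (n + 1))" unfolding nu_def by (rule LeastI_ex)
  have "N \<le> nu \<eta> (n + 1)"
  proof (rule ccontr)
    assume "\<not> N \<le> nu \<eta> (n + 1)"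
    then have "(\<Sum>i<nu \<eta> (n + 1). \<eta> i) \<le> (\<Sum>i<N. \<eta> i)" by (intro psum_mono[OF e]) auto
    then show False using P lt by simp
  qed
  then have "hat \<eta> n \<le> am \<eta> (N - 1)"
    unfolding hat_def by (intro decseqD[OF decseq_am[OF e]]) auto
  also have "am \<eta> (N - 1) = (\<Sum>i<N. \<eta> i) / real N" using N by (simp add: am_eq del: sum.lessThan_Suc)
  finally show ?thesis using h[of n] \<beta> by (meson mult_left_mono order_trans)
qed

lemma less_Suc_nat_floor: "y < real (Suc (nat \<lfloor>y\<rfloor>))" for y :: real
  by linarith

text \<open>
  Let \<open>A\<close> be the sum up to \<open>n\<close>. Up to the index \<open>N\<close> of order \<open>A/\<eta>(n)\<close> the partial sums at most double,
  so \<open>le_mean_if_le_hat\<close> applies at the much smaller index \<open>p\<close> of order \<open>2A/\<eta>(1)\<close> and gives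
  \<open>\<eta>(p) \<le> 4\<beta> \<eta>(n)\<close>. But the sum up to \<open>p\<close> is \<open>o(p)\<close>, a small fraction of \<open>A\<close>; therefore most of \<open>A\<close> is
  collected after \<open>p\<close>, where the entries are at most \<open>\<eta>(p)\<close>. The finitely many \<open>n\<close> for which \<open>p\<close>
  is not large enough are covered by positivity of \<open>\<eta>\<close>, a consequence of non-summability.
\<close>
lemma regular_if_le_hat:
  assumes e: "\<eta> \<in> c0star" and ns: "\<not> summable \<eta>" and \<beta>: "0 < \<beta>" and h: "\<And>n. \<eta> n \<le> \<beta> * hat \<eta> n"
  shows "am \<eta> \<in> O[principal UNIV](\<eta>)"
proof -
  let ?E = "\<lambda>n. \<Sum>i<n. \<eta> i"
  have pos: "0 < \<eta> n" for n
  proof (rule ccontr)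
    assume "\<not> 0 < \<eta> n"
    then have "\<eta> k = 0" if "k \<ge> n" for k
      using c0star_antimono[OF e that] c0starD(2)[OF e, of k] by simp
    then have "summable \<eta>" by (intro summable_finite[of "{..<n}"]) (auto simp: not_less)
    then show False using ns by simp
  qed
  have pos0: "0 < \<eta> 0" by (rule pos)
  obtain p0 where p0: "\<And>p. p \<ge> p0 \<Longrightarrow> am \<eta> p < \<eta> 0 / 8"
    using order_tendstoD(2)[OF am_tendsto_0[OF e], of "\<eta> 0 / 8"] pos0
    unfolding eventually_sequentially by auto
  have p0: "?E p \<le> \<eta> 0 / 8 * real p" if "p > p0" for p
  proof -
    have "am \<eta> (p - 1) < \<eta> 0 / 8" using that by (intro p0) simp
    moreover have "real p * am \<eta> (p - 1) = ?E p" using Suc_mult_am[of "p - 1" \<eta>] that by simp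
    ultimately show ?thesis
      using mult_left_mono[of "am \<eta> (p - 1)" "\<eta> 0 / 8" "real p"] by (simp add: mult.commute)
  qed
  obtain n0 where n0: "\<not> ?E n0 \<le> real (p0 + 1) * \<eta> 0"
    using ns summableI_nonneg_bounded[of \<eta> "real (p0 + 1) * \<eta> 0"] c0starD(2)[OF e] by blast
  have "norm (am \<eta> n) \<le> 6 * \<beta> * norm (\<eta> n)" if n: "n \<ge> n0" for n
  proof -
    define A where "A = ?E (Suc n)"
    have A0: "real (p0 + 1) * \<eta> 0 < A"
      using n0 psum_mono[OF e, of n0 "Suc n"] n unfolding A_def by linarith
    have "0 \<le> real (p0 + 1) * \<eta> 0" using pos0 by simp
    then have A: "0 < A" using A0 by linarith
    have A1: "real (Suc n) * \<eta> n \<le> A"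
      using am_ge[OF e, of n] Suc_mult_am[of n \<eta>] unfolding A_def
      by (metis mult_left_mono of_nat_0_le_iff)
    \<comment> \<open>The largest number of entries of size \<open>\<eta> n\<close> with total mass at most \<open>A\<close>.\<close>
    define N where "N = nat \<lfloor>A / \<eta> n\<rfloor>"
    have "1 * \<eta> n \<le> real (Suc n) * \<eta> n" using pos[of n] by (intro mult_right_mono) auto
    then have "\<eta> n \<le> A" using A1 by linarith
    then have 1: "1 \<le> A / \<eta> n" using pos[of n] by simp
    have N1: "real N \<le> A / \<eta> n" unfolding N_def using 1 by (intro of_nat_floor) linarith
    have N2: "A / \<eta> n < real (Suc N)" unfolding N_def by (rule less_Suc_nat_floor)
    then have "1 \<le> N" using 1 by linarith
    then have N: "real N \<le> A / \<eta> n" "A / \<eta> n < 2 * real N" "0 < N"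
      using N1 N2 by linarith+
    have EN: "?E N \<le> 2 * A"
    proof -
      have "?E N \<le> ?E (Suc n) + real N * \<eta> (Suc n)" by (rule psum_le_add[OF e])
      also have "\<dots> \<le> A + real N * \<eta> n"
        using c0star_antimono[OF e, of n "Suc n"] by (simp add: A_def mult_left_mono)
      also have "real N * \<eta> n \<le> A" using N(1) pos[of n] by (simp only: pos_le_divide_eq)
      finally show ?thesis by simp
    qed
    define p where "p = nat \<lfloor>2 * A / \<eta> 0\<rfloor>"
    have p1: "real p \<le> 2 * A / \<eta> 0"
      unfolding p_def using A pos0 by (intro of_nat_floor) auto
    have "2 * A / \<eta> 0 < real (Suc p)"
      unfolding p_def by (rule less_Suc_nat_floor)
    then have p2: "2 * A < real (Suc p) * \<eta> 0" using pos0 by (simp only: pos_divide_less_eq)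
    have "real (p0 + 1) * \<eta> 0 < real (Suc p) * \<eta> 0" using A0 A p2 by linarith
    then have "real (p0 + 1) < real (Suc p)" using pos0 by (simp only: mult_less_cancel_right_pos)
    then have "p0 < p" by simp
    have "\<eta> p \<le> \<beta> * (?E N / real N)"
    proof (rule le_mean_if_le_hat[OF e ns _ h N(3)])
      show "?E N < real (Suc p) * \<eta> 0" using EN p2 by linarith
    qed (use \<beta> in simp)
    also have "?E N / real N \<le> 4 * \<eta> n"
    proof -
      have "A < 2 * real N * \<eta> n" using N(2) pos[of n] by (simp only: pos_divide_less_eq)
      then have "?E N \<le> 4 * \<eta> n * real N" using EN by (simp add: ac_simps)
      then show ?thesis using N(3) by (simp add: pos_divide_le_eq)
    qed
    finally have ep: "\<eta> p \<le> 4 * \<beta> * \<eta> n" using \<beta> by (simp add: mult_left_mono)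
    have "A \<le> ?E p + real (Suc n) * \<eta> p" unfolding A_def by (rule psum_le_add[OF e])
    also have "?E p \<le> \<eta> 0 / 8 * real p" by (rule p0) fact
    also have "\<dots> \<le> \<eta> 0 / 8 * (2 * A / \<eta> 0)" using p1 pos0 by (intro mult_left_mono) auto
    also have "\<dots> = A / 4" using pos0 by simp
    also have "real (Suc n) * \<eta> p \<le> real (Suc n) * (4 * \<beta> * \<eta> n)"
      using ep by (intro mult_left_mono) auto
    also have "\<dots> = real (Suc n) * (\<beta> * \<eta> n) * 4" by (simp only: ac_simps)
    finally have "A \<le> 16 / 3 * (real (Suc n) * (\<beta> * \<eta> n))" by linarith
    also have "\<dots> \<le> 6 * (real (Suc n) * (\<beta> * \<eta> n))"
      using \<beta> pos[of n] by (intro mult_right_mono) auto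
    also have "\<dots> = 6 * \<beta> * \<eta> n * real (Suc n)" by (simp only: ac_simps)
    finally have "am \<eta> n \<le> 6 * \<beta> * \<eta> n"
      unfolding am_eq A_def[symmetric] by (simp only: pos_divide_le_eq of_nat_0_less_iff zero_less_Suc)
    then show ?thesis using am_nonneg[of \<eta> n] c0starD(2)[OF e] by simp
  qed
  then have "am \<eta> \<in> O(\<eta>)"
    by (intro bigoI[where c = "6 * \<beta>"] eventually_sequentiallyI[of n0])
  then show ?thesis by (rule bigo_everywhere_if_eventually) (rule pos)
qed

lemma sum_inverse_sqrt_le: "(\<Sum>i<n. 1 / sqrt (real (Suc i))) \<le> 2 * sqrt (real n)"
proof (induction n)
  case (Suc n)
  let ?a = "sqrt (real n)" and ?b = "sqrt (real (Suc n))"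
  have b: "?b > 0" by simp
  have "2 * ?a * ?b \<le> ?a^2 + ?b^2" using sum_squares_bound by blast
  also have "\<dots> = 2 * ?b^2 - 1" by simp
  finally have "2 * ?a + 1 / ?b \<le> 2 * ?b" using b by (simp add: field_simps power2_eq_square)
  then show ?case using Suc by simp
qed simp

text \<open>
  For \<open>i \<le> n\<close> both \<open>\<zeta>\<^sub>a(i) \<le> \<zeta>(1)\<close> and \<open>\<zeta>\<^sub>a(i) \<le> n \<zeta>\<^sub>a(n) / i\<close>. Their geometric mean decays
  like \<open>i\<close> to the power \<open>-1/2\<close>, so it sums to the order of \<open>n\<close> times a root of \<open>\<zeta>\<^sub>a(n)\<close>.
\<close>
lemma psum_am_le_sqrt:
  assumes z: "\<zeta> \<in> c0star"
  shows "(\<Sum>i<Suc n. am \<zeta> i) \<le> 2 * real (Suc n) * sqrt (\<zeta> 0 * am \<zeta> n)"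
proof -
  let ?x = "am \<zeta> n"
  have nn: "0 \<le> am \<zeta> i" for i using am_nonneg c0starD(2)[OF z] by blast
  have "am \<zeta> i \<le> sqrt (real (Suc n) * (\<zeta> 0 * ?x)) * (1 / sqrt (real (Suc i)))" if "i < Suc n" for i
  proof -
    have 1: "real (Suc i) * am \<zeta> i \<le> real (Suc n) * ?x"
      unfolding Suc_mult_am using that by (intro psum_mono[OF z]) auto
    have 2: "am \<zeta> i \<le> \<zeta> 0"
      using decseqD[OF decseq_am[OF z], of 0 i] by (simp add: am_def)
    have "real (Suc i) * (am \<zeta> i)\<^sup>2 = am \<zeta> i * (real (Suc i) * am \<zeta> i)"
      by (simp only: power2_eq_square ac_simps)
    also have "\<dots> \<le> \<zeta> 0 * (real (Suc n) * ?x)"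
      by (rule mult_mono[OF 2 1]) (use c0starD(2)[OF z] nn in \<open>auto intro!: mult_nonneg_nonneg\<close>)
    finally have "(am \<zeta> i)\<^sup>2 \<le> real (Suc n) * (\<zeta> 0 * ?x) / real (Suc i)"
      by (simp add: pos_le_divide_eq ac_simps del: of_nat_Suc)
    then have "am \<zeta> i \<le> sqrt (real (Suc n) * (\<zeta> 0 * ?x) / real (Suc i))"
      by (rule real_le_rsqrt)
    then show ?thesis by (simp add: real_sqrt_divide)
  qed
  then have "(\<Sum>i<Suc n. am \<zeta> i)
      \<le> (\<Sum>i<Suc n. sqrt (real (Suc n) * (\<zeta> 0 * ?x)) * (1 / sqrt (real (Suc i))))"
    by (intro sum_mono) auto
  also have "\<dots> = sqrt (real (Suc n) * (\<zeta> 0 * ?x)) * (\<Sum>i<Suc n. 1 / sqrt (real (Suc i)))"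
    by (rule sum_distrib_left[symmetric])
  also have "\<dots> \<le> sqrt (real (Suc n) * (\<zeta> 0 * ?x)) * (2 * sqrt (real (Suc n)))"
    by (intro mult_left_mono sum_inverse_sqrt_le) (auto intro!: mult_nonneg_nonneg nn c0starD(2)[OF z])
  also have "\<dots> = 2 * (sqrt (real (Suc n)) * sqrt (real (Suc n))) * sqrt (\<zeta> 0 * ?x)"
    by (simp only: real_sqrt_mult ac_simps)
  finally show ?thesis by simp
qed

text \<open>
  The index \<open>m\<close> is chosen such that the bounds for the two contributions to the sum of \<open>\<zeta>\<^sub>a\<close>
  up to \<open>m\<close>, from the entries before and after \<open>n\<close>, are of the same order \<open>m x\<close>, where \<open>x = \<zeta>\<^sub>a(n)\<close>.
\<close>
lemma bigo_am_if_le_hat: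
  assumes e: "\<eta> \<in> c0star" and z: "\<zeta> \<in> c0star"
    and ns: "\<not> summable \<eta>" and \<beta>: "0 < \<beta>" and h: "\<And>n. \<eta> n \<le> \<beta> * hat \<eta> n"
    and aa: "am (am \<eta>) \<in> O[principal UNIV](am (am \<zeta>))"
  shows "\<eta> \<in> O[principal UNIV](am \<zeta>)"
proof -
  note nn = am_nonneg[OF am_nonneg] am_nonneg c0starD(2)[OF e] c0starD(2)[OF z]
  obtain C where C: "C > 0" "\<And>n. am (am \<eta>) n \<le> C * am (am \<zeta>) n"
    using aa by (subst (asm) bigo_everywhere_iff) (auto intro: nn)
  have e0: "\<eta> 0 > 0"
    using ns c0star_pos_if_nonzero[OF e] by (metis summable_zero)
  have z0: "\<zeta> 0 > 0"
  proof -
    have "0 < am (am \<eta>) 0" using e0 by (simp add: am_def)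
    also have "\<dots> \<le> C * \<zeta> 0" using C(2)[of 0] by (simp add: am_def)
    finally show ?thesis using C(1) by (simp add: zero_less_mult_iff)
  qed
  define K where "K = 3 * C * \<beta> + 36 * C\<^sup>2 * \<zeta> 0 / \<eta> 0"
  have K: "K > 0" using C(1) \<beta> z0 e0 by (auto simp: K_def intro!: add_pos_pos)
  \<comment> \<open>One summand for each of the two cases for the partial sum up to \<open>m\<close>.\<close>
  have "\<eta> n \<le> K * am \<zeta> n" for n
  proof -
    define x where "x = am \<zeta> n"
    have x: "0 < x" "x \<le> \<zeta> 0"
      using am_pos[OF z z0] decseqD[OF decseq_am[OF z], of 0 n] by (auto simp: x_def am_def)
    define t where "t = real (Suc n) * sqrt (\<zeta> 0 / x)"
    have tn: "real (Suc n) \<le> t"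
      using x by (simp add: t_def mult_le_cancel_left1 del: of_nat_Suc)
    have "sqrt (\<zeta> 0 / x) * x = sqrt (\<zeta> 0) * (x / sqrt x)"
      by (simp add: real_sqrt_divide)
    also have "\<dots> = sqrt (\<zeta> 0 * x)"
      using x by (simp add: real_div_sqrt real_sqrt_mult)
    finally have tx: "t * x = real (Suc n) * sqrt (\<zeta> 0 * x)"
      by (simp only: t_def mult.assoc)
    define m where "m = nat \<lceil>t\<rceil>"
    have m: "t \<le> real m" "real m \<le> 2 * t" "Suc n \<le> m"
      unfolding m_def using tn by linarith+
    have Em: "(\<Sum>i<m. \<eta> i) \<le> 3 * C * (real m * x)"
    proof -
      have m1: "m = Suc (m - 1)" using m(3) by simp
      have "(\<Sum>i<m. \<eta> i) \<le> (\<Sum>i<m. am \<eta> i)" using am_ge[OF e] by (intro sum_mono) auto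
      also have "\<dots> = real m * am (am \<eta>) (m - 1)"
        using Suc_mult_am[of "m - 1" "am \<eta>"] m1 by simp
      also have "\<dots> \<le> real m * (C * am (am \<zeta>) (m - 1))"
        by (intro mult_left_mono C(2)) simp
      also have "\<dots> = C * (\<Sum>i<m. am \<zeta> i)"
        using Suc_mult_am[of "m - 1" "am \<zeta>"] m1 by simp
      also have "\<dots> \<le> C * ((\<Sum>i<Suc n. am \<zeta> i) + real m * am \<zeta> (Suc n))"
        using C(1) by (intro mult_left_mono psum_le_add am_in_c0star z) auto
      also have "real m * am \<zeta> (Suc n) \<le> real m * x"
        unfolding x_def by (intro mult_left_mono decseqD[OF decseq_am[OF z]]) auto
      also have "(\<Sum>i<Suc n. am \<zeta> i) \<le> 2 * (t * x)"
        using psum_am_le_sqrt[OF z, of n] unfolding tx by (simp only: mult.assoc x_def)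
      also have "t * x \<le> real m * x" using m(1) x(1) by (intro mult_right_mono) auto
      finally show ?thesis using C(1) by (simp add: ac_simps)
    qed
    have "\<eta> n \<le> 3 * C * \<beta> * x + 36 * C\<^sup>2 * \<zeta> 0 / \<eta> 0 * x"
    proof (cases "(\<Sum>i<m. \<eta> i) < real (Suc n) * \<eta> 0")
      case True
      have "\<eta> n \<le> \<beta> * ((\<Sum>i<m. \<eta> i) / real m)"
        using \<beta> m(3) by (intro le_mean_if_le_hat[OF e ns _ h _ True]) auto
      also have "\<dots> \<le> \<beta> * (3 * C * x)"
        using Em \<beta> m(3) by (intro mult_left_mono) (auto simp: divide_le_eq ac_simps)
      also have "\<dots> = 3 * C * \<beta> * x + 0" by simp
      also have "\<dots> \<le> 3 * C * \<beta> * x + 36 * C\<^sup>2 * \<zeta> 0 / \<eta> 0 * x"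
        using x z0 e0 by (intro add_left_mono) auto
      finally show ?thesis .
    next
      case False
      then have "real (Suc n) * \<eta> 0 \<le> 3 * C * (real m * x)" using Em by linarith
      also have "\<dots> \<le> 3 * C * (2 * t * x)"
        using m(2) C(1) x(1) by (intro mult_left_mono mult_right_mono) auto
      also have "\<dots> = real (Suc n) * (6 * C * sqrt (\<zeta> 0 * x))"
        using tx by (simp add: mult.assoc del: of_nat_Suc)
      finally have "\<eta> 0 \<le> 6 * C * sqrt (\<zeta> 0 * x)" by (simp only: mult_le_cancel_left_pos of_nat_0_less_iff zero_less_Suc)
      then have "(\<eta> 0)\<^sup>2 \<le> (6 * C * sqrt (\<zeta> 0 * x))\<^sup>2" using e0 by (intro power_mono) auto
      also have "\<dots> = 36 * C\<^sup>2 * \<zeta> 0 * x" using x z0 by (simp add: power_mult_distrib)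
      finally have "\<eta> 0 \<le> 36 * C\<^sup>2 * \<zeta> 0 / \<eta> 0 * x"
        using e0 by (simp add: field_simps power2_eq_square)
      moreover have "\<eta> n \<le> \<eta> 0" by (rule c0star_antimono[OF e]) simp
      moreover have "0 \<le> 3 * C * \<beta> * x" using C(1) \<beta> x by simp
      ultimately show ?thesis by linarith
    qed
    then show ?thesis by (simp add: K_def x_def algebra_simps)
  qed
  then show ?thesis using K by (subst bigo_everywhere_iff) (auto intro: nn)
qed

lemma am_cancel_hat:
  assumes e: "\<eta> \<in> c0star" and z: "\<zeta> \<in> c0star" and ah: "asymp_hat \<eta>"
    and aa: "am (am \<eta>) \<in> O[principal UNIV](am (am \<zeta>))"
  shows "am \<eta> \<in> O[principal UNIV](am \<zeta>)"
proof -
  obtain \<beta> where b: "\<not> summable \<eta>" "0 < \<beta>" "\<And>n. \<eta> n \<le> \<beta> * hat \<eta> n"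
    using ah unfolding asymp_hat_def asymp_seq_def by blast
  from regular_if_le_hat[OF e b] bigo_am_if_le_hat[OF e z b aa]
  show ?thesis by (rule bigo_everywhere_trans)
qed


section \<open>Every sequence decreasing to zero is a sequence of singular numbers\<close>

lemma cinner_zero_left [simp]: "cinner 0 y = 0"
  using cinner_add_left[of 0 0 y] by simp

lemma cinner_zero_right [simp]: "cinner x 0 = 0"
  using cinner_commute[of x 0] by simp

lemma cinner_add_right: "cinner x (y + z) = cinner x y + cinner x z"
  by (metis cinner_add_left cinner_commute complex_cnj_add)

lemma cinner_scaleC_right: "cinner x (scaleC c y) = cnj c * cinner x y"
  by (metis cinner_commute cinner_scaleC_left complex_cnj_mult)

lemma cinner_diff_left: "cinner (x - y) z = cinner x z - cinner y z"
  using cinner_add_left[of "x - y" y z] by (simp add: algebra_simps)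

lemma cinner_diff_right: "cinner x (y - z) = cinner x y - cinner x z"
  using cinner_add_right[of x "y - z" z] by (simp add: algebra_simps)

lemma cinner_sum_left: "cinner (\<Sum>i\<in>A. f i) z = (\<Sum>i\<in>A. cinner (f i) z)"
  by (induction A rule: infinite_finite_induct) (simp_all add: cinner_add_left)

lemma cinner_sum_right: "cinner z (\<Sum>i\<in>A. f i) = (\<Sum>i\<in>A. cinner z (f i))"
  by (induction A rule: infinite_finite_induct) (simp_all add: cinner_add_right)

lemma norm_sq_cinner: "(norm x)\<^sup>2 = Re (cinner x x)"
  by (simp add: norm_cinner)

lemma norm_scaleC: "norm (scaleC c x) = cmod c * norm x"
proof -
  have "complex_of_real ((norm (scaleC c x))\<^sup>2) = c * cnj c * cinner x x"
    by (simp only: norm_cinner[symmetric] cinner_scaleC_left cinner_scaleC_right ac_simps)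
  also have "\<dots> = complex_of_real ((cmod c)\<^sup>2 * (norm x)\<^sup>2)"
    by (simp only: norm_cinner complex_norm_square[symmetric] of_real_mult)
  finally have "(norm (scaleC c x))\<^sup>2 = (cmod c * norm x)\<^sup>2"
    by (simp only: of_real_eq_iff power_mult_distrib)
  then show ?thesis by (simp add: power2_eq_iff_nonneg)
qed

lemma Pythagoras_cinner:
  assumes "cinner (x - p) p = 0"
  shows "(norm x)\<^sup>2 = (norm (x - p))\<^sup>2 + (norm p)\<^sup>2"
proof -
  have "cinner p (x - p) = 0" using assms cinner_commute[of p "x - p"] by simp
  then have "cinner x x = cinner (x - p) (x - p) + cinner p p"
    using assms by (simp add: cinner_diff_left cinner_diff_right)
  then have "Re (cinner x x) = Re (cinner (x - p) (x - p)) + Re (cinner p p)" by simp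
  then show ?thesis by (simp only: norm_sq_cinner)
qed

definition orthonormal :: "(nat \<Rightarrow> 'h::complex_hilbert) \<Rightarrow> bool" where
  "orthonormal e \<longleftrightarrow> (\<forall>i j. cinner (e i) (e j) = (if i = j then 1 else 0))"

lemma orthonormalD: "orthonormal e \<Longrightarrow> cinner (e i) (e j) = (if i = j then 1 else 0)"
  by (simp add: orthonormal_def)

lemma cinner_lincomb_orthonormal:
  assumes "orthonormal e" "finite A"
  shows "cinner (\<Sum>i\<in>A. scaleC (c i) (e i)) (e j) = (if j \<in> A then c j else 0)"
proof -
  have "cinner (\<Sum>i\<in>A. scaleC (c i) (e i)) (e j) = (\<Sum>i\<in>A. if i = j then c i else 0)"
    using assms by (simp add: cinner_sum_left cinner_scaleC_left orthonormalD if_distrib cong: if_cong)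
  then show ?thesis using assms by simp
qed

lemma norm_lincomb_orthonormal:
  assumes "orthonormal e" "finite A"
  shows "(norm (\<Sum>i\<in>A. scaleC (c i) (e i)))\<^sup>2 = (\<Sum>i\<in>A. (cmod (c i))\<^sup>2)"
proof -
  let ?s = "\<Sum>i\<in>A. scaleC (c i) (e i)"
  have "complex_of_real ((norm ?s)\<^sup>2) = cinner ?s ?s" by (simp add: norm_cinner)
  also have "\<dots> = (\<Sum>j\<in>A. cnj (c j) * cinner ?s (e j))"
    by (simp only: cinner_sum_right cinner_scaleC_right)
  also have "\<dots> = (\<Sum>j\<in>A. cnj (c j) * c j)"
    using assms by (intro sum.cong refl) (simp add: cinner_lincomb_orthonormal)
  also have "\<dots> = complex_of_real (\<Sum>i\<in>A. (cmod (c i))\<^sup>2)"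
    unfolding of_real_sum by (intro sum.cong refl) (simp only: complex_norm_square mult.commute)
  finally show ?thesis by (simp only: of_real_eq_iff)
qed

text \<open>The projection of \<open>x\<close> onto the span of the \<open>e i\<close> is orthogonal to its complement in \<open>x\<close>.\<close>
lemma Bessel_inequality:
  assumes e: "orthonormal e" and A: "finite A"
  shows "(\<Sum>i\<in>A. (cmod (cinner x (e i)))\<^sup>2) \<le> (norm x)\<^sup>2"
proof -
  define p where "p = (\<Sum>i\<in>A. scaleC (cinner x (e i)) (e i))"
  have 0: "cinner (x - p) (e j) = 0" if "j \<in> A" for j
    using that by (simp add: cinner_diff_left p_def cinner_lincomb_orthonormal[OF e A])
  have "cinner (x - p) (\<Sum>i\<in>A. scaleC (cinner x (e i)) (e i)) = 0"
    unfolding cinner_sum_right cinner_scaleC_right by (intro sum.neutral ballI) (simp add: 0)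
  then have "cinner (x - p) p = 0" unfolding p_def[symmetric] .
  then have "(norm p)\<^sup>2 \<le> (norm x)\<^sup>2" using Pythagoras_cinner by fastforce
  then show ?thesis unfolding p_def norm_lincomb_orthonormal[OF e A] .
qed

lemma Cauchy_Schwarz_cinner: "cmod (cinner x y) \<le> norm x * norm y"
proof (cases "y = 0")
  case False
  define c where "c = cinner x y / complex_of_real ((norm y)\<^sup>2)"
  have y: "norm y > 0" using False by simp
  have "cinner (x - scaleC c y) y = 0"
    using y by (simp add: cinner_diff_left cinner_scaleC_left norm_cinner c_def)
  then have "cinner (x - scaleC c y) (scaleC c y) = 0"
    by (simp add: cinner_scaleC_right)
  from Pythagoras_cinner[OF this] have "(norm (scaleC c y))\<^sup>2 \<le> (norm x)\<^sup>2" by simp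
  then have "norm (scaleC c y) \<le> norm x" by (rule power2_le_imp_le) simp
  then have "cmod c * norm y \<le> norm x" by (simp only: norm_scaleC)
  moreover have "cmod c * norm y = cmod (cinner x y) / norm y"
    using y by (simp add: c_def norm_divide norm_mult power2_eq_square)
  ultimately show ?thesis using y by (simp add: pos_divide_le_eq)
qed simp

lemma bounded_linear_cinner_left: "bounded_linear (\<lambda>x. cinner x y)"
proof (rule bounded_linear_intro[where K = "norm y"])
  show "cinner (r *\<^sub>R x) y = r *\<^sub>R cinner x y" for r x
    by (simp only: scaleC_of_real[symmetric] cinner_scaleC_left scaleR_conv_of_real)
qed (rule cinner_add_left, rule Cauchy_Schwarz_cinner)

lemma bounded_linear_cinner_right: "bounded_linear (\<lambda>y. cinner x y)"
proof (rule bounded_linear_intro[where K = "norm x"])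
  show "cinner x (r *\<^sub>R y) = r *\<^sub>R cinner x y" for r y
    by (simp only: scaleC_of_real[symmetric] cinner_scaleC_right scaleR_conv_of_real complex_cnj_complex_of_real)
  show "norm (cinner x y) \<le> norm y * norm x" for y
    using Cauchy_Schwarz_cinner[of x y] by (simp only: mult.commute)
qed (rule cinner_add_right)

lemma bounded_linear_scaleC_right: "bounded_linear (scaleC c :: 'h::complex_hilbert \<Rightarrow> 'h)"
proof (rule bounded_linear_intro[where K = "cmod c"])
  show "scaleC c (r *\<^sub>R x) = r *\<^sub>R scaleC c x" for r and x :: 'h
    by (simp only: scaleC_of_real[symmetric] scaleC_scaleC mult.commute)
  show "norm (scaleC c x) \<le> norm x * cmod c" for x :: 'h
    by (simp add: norm_scaleC mult.commute)
qed (rule scaleC_add_right)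

lemma bounded_linear_scaleC_left: "bounded_linear (\<lambda>c. scaleC c (x :: 'h::complex_hilbert))"
proof (rule bounded_linear_intro[where K = "norm x"])
  show "scaleC (r *\<^sub>R c) x = r *\<^sub>R scaleC c x" for r c
    by (simp only: scaleC_of_real[symmetric] scaleC_scaleC scaleR_conv_of_real)
  show "norm (scaleC c x) \<le> norm c * norm x" for c
    by (simp add: norm_scaleC)
qed (rule scaleC_add_left)

text \<open>One Gram--Schmidt step, applied to a vector outside the span of \<open>F\<close>.\<close>
lemma ex_unit_vector_orthogonal:
  fixes F :: "'h::complex_hilbert set"
  assumes inf: "infinite_dimensional TYPE('h)" and F: "finite F"
    and on: "\<And>f g. f \<in> F \<Longrightarrow> g \<in> F \<Longrightarrow> cinner f g = (if f = g then 1 else 0)"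
  shows "\<exists>u. cinner u u = 1 \<and> (\<forall>f\<in>F. cinner u f = 0)"
proof -
  obtain v where v: "v \<notin> complex_vector.span F"
    using inf F unfolding infinite_dimensional_def by blast
  define w where "w = v - (\<Sum>f\<in>F. scaleC (cinner v f) f)"
  have "(\<Sum>f\<in>F. scaleC (cinner v f) f) \<in> complex_vector.span F"
    by (intro complex_vector.span_sum complex_vector.span_scale complex_vector.span_base)
  then have "w \<noteq> 0" using v by (auto simp: w_def)
  have orth: "cinner w g = 0" if g: "g \<in> F" for g
  proof -
    have "(\<Sum>f\<in>F. cinner v f * cinner f g) = (\<Sum>f\<in>F. if f = g then cinner v f else 0)"
      using on g by (intro sum.cong refl) auto
    then show ?thesis
      using F g by (simp add: w_def cinner_diff_left cinner_sum_left cinner_scaleC_left)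
  qed
  define u where "u = scaleC (complex_of_real (1 / norm w)) w"
  have "cinner u u = 1"
    using \<open>w \<noteq> 0\<close> unfolding u_def norm_cinner norm_scaleC by (simp add: norm_divide)
  moreover have "\<forall>f\<in>F. cinner u f = 0" by (simp add: u_def cinner_scaleC_left orth)
  ultimately show ?thesis by blast
qed

lemma ex_orthonormal:
  assumes inf: "infinite_dimensional TYPE('h::complex_hilbert)"
  shows "\<exists>e :: nat \<Rightarrow> 'h. orthonormal e"
proof -
  \<comment> \<open>The property carries the orthonormality of the earlier vectors as a premise, so that the choice
    is possible after any initial sequence; induction discharges the premise afterwards.\<close>
  let ?P = "\<lambda>(e :: nat \<Rightarrow> 'h) n u. (\<forall>i<n. \<forall>j<n. cinner (e i) (e j) = (if i = j then 1 else 0)) \<longrightarrow>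
      cinner u u = 1 \<and> (\<forall>i<n. cinner u (e i) = 0)"
  have "\<exists>e. \<forall>n. ?P e n (e n)"
  proof (rule dependent_wellorder_choice)
    fix e :: "nat \<Rightarrow> 'h" and n
    show "\<exists>u. ?P e n u"
    proof (cases "\<forall>i<n. \<forall>j<n. cinner (e i) (e j) = (if i = j then 1 else 0)")
      case True
      have "cinner f g = (if f = g then 1 else 0)" if fg: "f \<in> e ` {..<n}" "g \<in> e ` {..<n}" for f g
      proof -
        obtain i j where ij: "f = e i" "g = e j" "i < n" "j < n" using fg by auto
        have "cinner (e i) (e i) = 1" using True ij by auto
        moreover have "cinner (e i) (e j) = (if i = j then 1 else 0)" using True ij by auto
        ultimately have "e i = e j \<longleftrightarrow> i = j" by (auto split: if_splits)
        then show ?thesis using True ij by simp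
      qed
      then obtain u where "cinner u u = 1" "\<forall>f\<in>e ` {..<n}. cinner u f = 0"
        using ex_unit_vector_orthogonal[OF inf, of "e ` {..<n}"] by auto
      then show ?thesis by auto
    next
      case False
      then show ?thesis by blast
    qed
  qed simp
  then obtain e where e: "\<And>n. ?P e n (e n)" by blast
  have on: "\<forall>i<n. \<forall>j<n. cinner (e i) (e j) = (if i = j then 1 else 0)" for n
  proof (induction n)
    case (Suc n)
    have n: "cinner (e n) (e n) = 1" "\<And>i. i < n \<Longrightarrow> cinner (e n) (e i) = 0" using e[of n] Suc by auto
    then have "cinner (e i) (e n) = 0" if "i < n" for i
      using that by (metis cinner_commute complex_cnj_zero)
    then show ?case using n Suc by (auto simp: less_Suc_eq)
  qed simp
  have "cinner (e i) (e j) = (if i = j then 1 else 0)" for i j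
    using on[of "Suc (max i j)"] by (auto simp: less_Suc_eq_le)
  then show ?thesis unfolding orthonormal_def by blast
qed

lemma inj_orthonormal: "orthonormal e \<Longrightarrow> inj e"
proof (rule injI)
  fix i j assume "orthonormal e" "e i = e j"
  then show "i = j" using orthonormalD[of e i j] orthonormalD[of e j j] by (simp split: if_splits)
qed

lemma independent_orthonormal:
  assumes e: "orthonormal e" and A: "finite A"
  shows "complex_vector.independent (e ` A)"
proof -
  have inj: "inj_on e A" using inj_orthonormal[OF e] by (rule inj_on_subset) simp
  have "u (e j) = 0" if z: "(\<Sum>v\<in>e ` A. scaleC (u v) v) = 0" and j: "j \<in> A" for u j
  proof -
    have "(\<Sum>i\<in>A. scaleC (u (e i)) (e i)) = 0"
      using z by (simp add: sum.reindex[OF inj])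
    then show ?thesis
      using cinner_lincomb_orthonormal[OF e A, of "\<lambda>i. u (e i)" j] j by simp
  qed
  then show ?thesis using A by (auto simp: complex_vector.dependent_finite)
qed

definition trunc_op :: "(nat \<Rightarrow> 'h::complex_hilbert) \<Rightarrow> (nat \<Rightarrow> real) \<Rightarrow> nat \<Rightarrow> 'h \<Rightarrow>\<^sub>L 'h" where
  "trunc_op e \<sigma> N = Blinfun (\<lambda>x. \<Sum>n<N. scaleC (complex_of_real (\<sigma> n) * cinner x (e n)) (e n))"

lemma trunc_op_apply:
  "blinfun_apply (trunc_op e \<sigma> N) x = (\<Sum>n<N. scaleC (complex_of_real (\<sigma> n) * cinner x (e n)) (e n))"
proof -
  have "bounded_linear (\<lambda>x. \<Sum>n<N. scaleC (complex_of_real (\<sigma> n) * cinner x (e n)) (e n))"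
    by (intro bounded_linear_sum bounded_linear_compose[OF bounded_linear_scaleC_left]
        bounded_linear_const_mult bounded_linear_cinner_left)
  then show ?thesis by (simp add: trunc_op_def bounded_linear_Blinfun_apply)
qed

text \<open>
  Although \<open>\<sigma>\<close> need not be summable, the truncations form a Cauchy sequence in operator norm: by
  orthogonality only the largest of the differing entries counts.
\<close>
lemma norm_trunc_op_diff:
  assumes e: "orthonormal e" and s: "\<sigma> \<in> c0star" and MN: "M \<le> N"
  shows "norm (trunc_op e \<sigma> N - trunc_op e \<sigma> M) \<le> \<sigma> M"
proof (rule norm_blinfun_bound)
  fix x
  have "blinfun_apply (trunc_op e \<sigma> N - trunc_op e \<sigma> M) x
      = (\<Sum>n=M..<N. scaleC (complex_of_real (\<sigma> n) * cinner x (e n)) (e n))"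
    unfolding blinfun.diff_left trunc_op_apply lessThan_atLeast0
    by (rule sum_diff_nat_ivl) (use MN in auto)
  then have "(norm (blinfun_apply (trunc_op e \<sigma> N - trunc_op e \<sigma> M) x))\<^sup>2
      = (\<Sum>n=M..<N. (\<sigma> n)\<^sup>2 * (cmod (cinner x (e n)))\<^sup>2)"
    by (simp add: norm_lincomb_orthonormal[OF e] norm_mult power_mult_distrib)
  also have "\<dots> \<le> (\<Sum>n=M..<N. (\<sigma> M)\<^sup>2 * (cmod (cinner x (e n)))\<^sup>2)"
    using c0star_antimono[OF s] c0starD(2)[OF s]
    by (intro sum_mono mult_right_mono power_mono) auto
  also have "\<dots> \<le> (\<sigma> M)\<^sup>2 * (norm x)\<^sup>2"
    unfolding sum_distrib_left[symmetric] by (intro mult_left_mono Bessel_inequality[OF e]) auto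
  also have "\<dots> = (\<sigma> M * norm x)\<^sup>2" by (rule power_mult_distrib[symmetric])
  finally show "norm (blinfun_apply (trunc_op e \<sigma> N - trunc_op e \<sigma> M) x) \<le> \<sigma> M * norm x"
    by (rule power2_le_imp_le) (use c0starD(2)[OF s] in simp)
qed (rule c0starD(2)[OF s])

text \<open>
  These sets contain the images of the unit ball under the truncated operators; they are continuous
  images of finite products of discs.
\<close>
lemma compact_lincombs:
  fixes e :: "nat \<Rightarrow> 'h::complex_hilbert"
  shows "compact {\<Sum>n<N. scaleC (c n) (e n) |c. \<forall>n<N. cmod (c n) \<le> r}"
proof (induction N)
  case (Suc N)
  let ?K = "\<lambda>N. {\<Sum>n<N. scaleC (c n) (e n) |c. \<forall>n<N. cmod (c n) \<le> r}"
  let ?f = "\<lambda>(a, c). a + scaleC c (e N)"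
  have "compact (?f ` (?K N \<times> cball 0 r))"
    unfolding case_prod_unfold
    by (intro compact_continuous_image compact_Times Suc compact_cball continuous_intros
        bounded_linear.continuous_on[OF bounded_linear_scaleC_left])
  moreover have "?K (Suc N) = ?f ` (?K N \<times> cball 0 r)"
  proof (intro equalityI subsetI)
    fix y assume "y \<in> ?K (Suc N)"
    then obtain c where "y = (\<Sum>n<Suc N. scaleC (c n) (e n))" "\<forall>n<Suc N. cmod (c n) \<le> r" by blast
    then show "y \<in> ?f ` (?K N \<times> cball 0 r)"
      by (intro image_eqI[of _ _ "(\<Sum>n<N. scaleC (c n) (e n), c N)"]) auto
  next
    fix y assume "y \<in> ?f ` (?K N \<times> cball 0 r)"
    then obtain c d where y: "y = (\<Sum>n<N. scaleC (c n) (e n)) + scaleC d (e N)"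
      and c: "\<forall>n<N. cmod (c n) \<le> r" and d: "cmod d \<le> r" by auto
    have "(\<Sum>n<N. scaleC ((c(N := d)) n) (e n)) = (\<Sum>n<N. scaleC (c n) (e n))"
      by (intro sum.cong) auto
    then show "y \<in> ?K (Suc N)"
      using y c d by (intro CollectI exI[of _ "c(N := d)"]) (auto simp: less_Suc_eq)
  qed
  ultimately show ?case by simp
qed simp

text \<open>
  Finite nets of the approximating compact sets are finite nets of \<open>S\<close>, up to a larger radius.
\<close>
lemma compact_closure_if_approx:
  fixes S :: "'a::banach set"
  assumes "\<And>\<epsilon>. 0 < \<epsilon> \<Longrightarrow> \<exists>K. compact K \<and> (\<forall>x\<in>S. \<exists>y\<in>K. dist x y < \<epsilon>)"
  shows "compact (closure S)"
  unfolding compact_eq_totally_bounded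
proof (intro conjI allI impI)
  show "complete (closure S)" by (simp add: complete_eq_closed)
  fix \<epsilon> :: real assume eps: "0 < \<epsilon>"
  then obtain K where K: "compact K" "\<And>x. x \<in> S \<Longrightarrow> \<exists>y\<in>K. dist x y < \<epsilon> / 3"
    using assms[of "\<epsilon> / 3"] by auto
  obtain k where k: "finite k" "K \<subseteq> (\<Union>x\<in>k. ball x (\<epsilon> / 3))"
    using K(1) eps unfolding compact_eq_totally_bounded by (meson divide_pos_pos zero_less_numeral)
  have "x \<in> (\<Union>x\<in>k. ball x \<epsilon>)" if "x \<in> closure S" for x
  proof -
    obtain y where y: "y \<in> S" "dist y x < \<epsilon> / 3"
      using \<open>x \<in> closure S\<close> eps unfolding closure_approachable by (meson divide_pos_pos zero_less_numeral)
    obtain z where z: "z \<in> K" "dist y z < \<epsilon> / 3" using K(2)[OF y(1)] by blast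
    obtain a where a: "a \<in> k" "dist a z < \<epsilon> / 3" using k(2) z(1) by auto
    have "dist a x \<le> dist a z + (dist z y + dist y x)"
      using dist_triangle[of a x z] dist_triangle[of z x y] by linarith
    then have "dist a x < \<epsilon>" using a y z by (simp add: dist_commute)
    then show ?thesis using a(1) by auto
  qed
  then show "\<exists>k. finite k \<and> closure S \<subseteq> (\<Union>x\<in>k. ball x \<epsilon>)" using k(1) by blast
qed

text \<open>
  The operator is the norm limit \<open>X\<close> of the truncations, which is self-adjoint and compact. For
  \<open>t > 0\<close>, an eigenvector of \<open>X\<^sup>*X = X\<^sup>2\<close> with eigenvalue \<open>t\<^sup>2\<close> has coefficients only at the \<open>e n\<close> with
  \<open>\<sigma> n = t\<close>. It equals \<open>t\<^sup>-\<^sup>2 X\<^sup>2 x\<close>, hence lies in the range of \<open>X\<close> and thus in the span of these \<open>e n\<close>;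
  so nothing orthogonal to all \<open>e n\<close> contributes to the multiplicity of \<open>t\<close>.
\<close>
lemma ex_diagonal_operator:
  assumes e: "orthonormal (e :: nat \<Rightarrow> 'h::complex_hilbert)" and s: "\<sigma> \<in> c0star"
  shows "\<exists>X :: 'h \<Rightarrow>\<^sub>L 'h. snumbers X \<sigma>"
proof -
  let ?P = "trunc_op e \<sigma>"
  have "Cauchy ?P"
  proof (rule metric_CauchyI)
    fix \<epsilon> :: real assume eps: "0 < \<epsilon>"
    then obtain M where M: "\<sigma> M < \<epsilon> / 2"
      using order_tendstoD(2)[OF c0starD(3)[OF s], of "\<epsilon> / 2"] unfolding eventually_sequentially by auto
    have "dist (?P m) (?P n) < \<epsilon>" if "m \<ge> M" "n \<ge> M" for m n
      using norm_trunc_op_diff[OF e s that(1)] norm_trunc_op_diff[OF e s that(2)] M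
        dist_triangle2[of "?P m" "?P n" "?P M"] by (simp add: dist_norm)
    then show "\<exists>M. \<forall>m\<ge>M. \<forall>n\<ge>M. dist (?P m) (?P n) < \<epsilon>" by blast
  qed
  then obtain X where lim: "?P \<longlonglongrightarrow> X" using Cauchy_convergent convergent_def by blast
  have lim_app: "(\<lambda>N. blinfun_apply (?P N) x) \<longlonglongrightarrow> blinfun_apply X x" for x
    by (intro tendsto_intros lim)
  have X_P: "norm (X - ?P M) \<le> \<sigma> M" for M
  proof (rule LIMSEQ_le_const2)
    show "(\<lambda>N. norm (?P N - ?P M)) \<longlonglongrightarrow> norm (X - ?P M)" by (intro tendsto_intros lim)
    show "\<exists>N. \<forall>n\<ge>N. norm (?P n - ?P M) \<le> \<sigma> M" using norm_trunc_op_diff[OF e s] by blast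
  qed
  have X_lin: "X \<in> bounded_operators"
    unfolding bounded_operators_def
  proof (intro CollectI allI)
    fix c x
    have "blinfun_apply (?P N) (scaleC c x) = scaleC c (blinfun_apply (?P N) x)" for N
      by (simp add: trunc_op_apply complex_vector.scale_sum_right scaleC_scaleC cinner_scaleC_left ac_simps)
    then have "(\<lambda>N. scaleC c (blinfun_apply (?P N) x)) \<longlonglongrightarrow> blinfun_apply X (scaleC c x)"
      using lim_app[of "scaleC c x"] by simp
    moreover have "(\<lambda>N. scaleC c (blinfun_apply (?P N) x)) \<longlonglongrightarrow> scaleC c (blinfun_apply X x)"
      by (intro bounded_linear.tendsto[OF bounded_linear_scaleC_right] lim_app)
    ultimately show "blinfun_apply X (scaleC c x) = scaleC c (blinfun_apply X x)"
      by (rule LIMSEQ_unique)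
  qed
  have X_coeff: "cinner (blinfun_apply X x) (e n) = complex_of_real (\<sigma> n) * cinner x (e n)" for x n
  proof (rule LIMSEQ_unique)
    show "(\<lambda>N. cinner (blinfun_apply (?P N) x) (e n)) \<longlonglongrightarrow> cinner (blinfun_apply X x) (e n)"
      by (intro bounded_linear.tendsto[OF bounded_linear_cinner_left] lim_app)
    have "cinner (blinfun_apply (?P N) x) (e n) = complex_of_real (\<sigma> n) * cinner x (e n)" if "n < N" for N
      using that by (simp add: trunc_op_apply cinner_lincomb_orthonormal[OF e])
    then show "(\<lambda>N. cinner (blinfun_apply (?P N) x) (e n)) \<longlonglongrightarrow> complex_of_real (\<sigma> n) * cinner x (e n)"
      by (intro tendsto_eventually eventually_sequentiallyI[of "Suc n"]) auto
  qed
  have X_selfadj: "cinner (blinfun_apply X x) y = cinner x (blinfun_apply X y)" for x y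
  proof (rule LIMSEQ_unique)
    show "(\<lambda>N. cinner (blinfun_apply (?P N) x) y) \<longlonglongrightarrow> cinner (blinfun_apply X x) y"
      by (intro bounded_linear.tendsto[OF bounded_linear_cinner_left] lim_app)
    have "cinner (blinfun_apply (?P N) x) y = cinner x (blinfun_apply (?P N) y)" for N
      unfolding trunc_op_apply cinner_sum_left cinner_sum_right cinner_scaleC_left cinner_scaleC_right
      by (intro sum.cong refl) (simp add: cinner_commute[of y])
    moreover have "(\<lambda>N. cinner x (blinfun_apply (?P N) y)) \<longlonglongrightarrow> cinner x (blinfun_apply X y)"
      by (intro bounded_linear.tendsto[OF bounded_linear_cinner_right] lim_app)
    ultimately show "(\<lambda>N. cinner (blinfun_apply (?P N) x) y) \<longlonglongrightarrow> cinner x (blinfun_apply X y)" by simp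
  qed
  have adj: "hilbert_adjoint X = X"
    unfolding hilbert_adjoint_def
  proof (rule the_equality)
    show "\<forall>x y. cinner (blinfun_apply X x) y = cinner x (blinfun_apply X y)" using X_selfadj by blast
    fix Y assume Y: "\<forall>x y. cinner (blinfun_apply Y x) y = cinner x (blinfun_apply X y)"
    show "Y = X"
    proof (rule blinfun_eqI)
      fix x
      let ?d = "blinfun_apply Y x - blinfun_apply X x"
      have "cinner ?d ?d = 0" using Y X_selfadj by (simp add: cinner_diff_left)
      then have "(norm ?d)\<^sup>2 = 0" by (simp add: norm_sq_cinner)
      then show "blinfun_apply Y x = blinfun_apply X x" by simp
    qed
  qed
  have "compact (closure (blinfun_apply X ` cball 0 1))"
  proof (rule compact_closure_if_approx)
    fix \<epsilon> :: real assume eps: "0 < \<epsilon>"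
    then obtain M where M: "\<sigma> M < \<epsilon>"
      using order_tendstoD(2)[OF c0starD(3)[OF s], of \<epsilon>] unfolding eventually_sequentially by auto
    let ?K = "{\<Sum>n<M. scaleC (c n) (e n) |c. \<forall>n<M. cmod (c n) \<le> \<sigma> 0}"
    have "\<exists>y\<in>?K. dist (blinfun_apply X x) y < \<epsilon>" if x: "x \<in> cball 0 1" for x
    proof
      have "norm x \<le> 1" using x by simp
      have "cmod (cinner x (e n)) \<le> 1" for n
      proof -
        have "cmod (cinner x (e n)) \<le> norm x * norm (e n)" by (rule Cauchy_Schwarz_cinner)
        moreover have "(norm (e n))\<^sup>2 = 1" by (simp add: norm_sq_cinner orthonormalD[OF e])
        then have "norm (e n) = 1" using norm_ge_zero[of "e n"] by (simp only: power2_eq_1_iff) linarith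
        ultimately show ?thesis using \<open>norm x \<le> 1\<close> by simp
      qed
      then have "\<sigma> n * cmod (cinner x (e n)) \<le> \<sigma> 0 * 1" for n
        using c0star_antimono[OF s, of 0 n] c0starD(2)[OF s] by (intro mult_mono) auto
      then show "blinfun_apply (?P M) x \<in> ?K"
        unfolding trunc_op_apply using c0starD(2)[OF s]
        by (intro CollectI exI[of _ "\<lambda>n. complex_of_real (\<sigma> n) * cinner x (e n)"]) (simp add: norm_mult)
      have "norm (blinfun_apply (X - ?P M) x) \<le> norm (X - ?P M) * norm x" by (rule norm_blinfun)
      also have "\<dots> \<le> \<sigma> M * 1" using X_P \<open>norm x \<le> 1\<close> c0starD(2)[OF s] by (intro mult_mono) auto
      finally show "dist (blinfun_apply X x) (blinfun_apply (?P M) x) < \<epsilon>"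
        using M by (simp add: dist_norm blinfun.diff_left)
    qed
    then show "\<exists>K. compact K \<and> (\<forall>x\<in>blinfun_apply X ` cball 0 1. \<exists>y\<in>K. dist x y < \<epsilon>)"
      by (intro exI[of _ ?K]) (auto intro!: compact_lincombs)
  qed
  then have comp: "compact_operator X" using X_lin by (simp add: compact_operator_def)
  have "card {n. \<sigma> n = t} =
        complex_vector.dim {x. hilbert_adjoint X (blinfun_apply X x) = scaleC (complex_of_real (t\<^sup>2)) x}"
    if t: "t > 0" for t
  proof -
    define A where "A = {n. \<sigma> n = t}"
    let ?V = "{x. blinfun_apply X (blinfun_apply X x) = scaleC (complex_of_real (t\<^sup>2)) x}"
    obtain N0 where N0: "\<And>n. n \<ge> N0 \<Longrightarrow> \<sigma> n < t"
      using order_tendstoD(2)[OF c0starD(3)[OF s] t] unfolding eventually_sequentially by auto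
    have A: "A \<subseteq> {..<N0}"
    proof
      fix n assume "n \<in> A"
      then have "\<not> N0 \<le> n" using N0[of n] by (auto simp: A_def)
      then show "n \<in> {..<N0}" by simp
    qed
    then have finA: "finite A" using finite_subset by blast
    have inj: "inj_on e A" using inj_orthonormal[OF e] by (rule inj_on_subset) simp
    have X_e: "blinfun_apply X (e n) = scaleC (complex_of_real (\<sigma> n)) (e n)" for n
    proof (rule LIMSEQ_unique[OF lim_app])
      have "blinfun_apply (?P N) (e n) = scaleC (complex_of_real (\<sigma> n)) (e n)" if "n < N" for N
      proof -
        have "blinfun_apply (?P N) (e n) = (\<Sum>m<N. if m = n then scaleC (complex_of_real (\<sigma> m)) (e m) else 0)"
          unfolding trunc_op_apply by (intro sum.cong refl) (simp add: orthonormalD[OF e])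
        then show ?thesis using that by simp
      qed
      then show "(\<lambda>N. blinfun_apply (?P N) (e n)) \<longlonglongrightarrow> scaleC (complex_of_real (\<sigma> n)) (e n)"
        by (intro tendsto_eventually eventually_sequentiallyI[of "Suc n"]) auto
    qed
    have X_scale: "blinfun_apply X (scaleC c x) = scaleC c (blinfun_apply X x)" for c x
      using X_lin by (simp add: bounded_operators_def)
    have V1: "e ` A \<subseteq> ?V" by (auto simp: A_def X_e X_scale scaleC_scaleC power2_eq_square)
    have X_span: "blinfun_apply X x \<in> complex_vector.span (e ` A)"
      if coeff: "\<And>n. n \<notin> A \<Longrightarrow> cinner x (e n) = 0" for x
    proof -
      have "blinfun_apply (?P N) x = (\<Sum>n\<in>A. scaleC (complex_of_real (\<sigma> n) * cinner x (e n)) (e n))"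
        if "N \<ge> N0" for N
        unfolding trunc_op_apply using A that coeff by (intro sum.mono_neutral_right) auto
      then have "blinfun_apply X x = (\<Sum>n\<in>A. scaleC (complex_of_real (\<sigma> n) * cinner x (e n)) (e n))"
        by (intro LIMSEQ_unique[OF lim_app] tendsto_eventually eventually_sequentiallyI[of N0])
      then show ?thesis
        by (simp only:) (intro complex_vector.span_sum complex_vector.span_scale
          complex_vector.span_base imageI)
    qed
    have V2: "?V \<subseteq> complex_vector.span (e ` A)"
    proof
      fix x assume "x \<in> ?V"
      then have x: "blinfun_apply X (blinfun_apply X x) = scaleC (complex_of_real (t\<^sup>2)) x" by simp
      have c: "cinner x (e n) = 0" if "n \<notin> A" for n
      proof -
        have "complex_of_real (\<sigma> n) * (complex_of_real (\<sigma> n) * cinner x (e n))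
            = cinner (blinfun_apply X (blinfun_apply X x)) (e n)"
          by (simp only: X_coeff)
        also have "\<dots> = complex_of_real (t\<^sup>2) * cinner x (e n)"
          by (simp only: x cinner_scaleC_left)
        finally have "complex_of_real ((\<sigma> n)\<^sup>2) * cinner x (e n) = complex_of_real (t\<^sup>2) * cinner x (e n)"
          by (simp only: power2_eq_square of_real_mult mult.assoc)
        moreover have "(\<sigma> n)\<^sup>2 \<noteq> t\<^sup>2"
          using \<open>n \<notin> A\<close> t c0starD(2)[OF s, of n] by (simp add: A_def power2_eq_iff_nonneg)
        ultimately show ?thesis by (simp only: mult_cancel_right of_real_eq_iff simp_thms)
      qed
      have "scaleC (complex_of_real (t\<^sup>2)) x \<in> complex_vector.span (e ` A)"
        unfolding x[symmetric] by (rule X_span) (simp add: X_coeff c)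
      then have "scaleC (complex_of_real (1 / t\<^sup>2)) (scaleC (complex_of_real (t\<^sup>2)) x) \<in> complex_vector.span (e ` A)"
        by (rule complex_vector.span_scale)
      then show "x \<in> complex_vector.span (e ` A)"
        using t by (simp only: scaleC_scaleC of_real_mult[symmetric]) (simp add: scaleC_one)
    qed
    have "card (e ` A) = complex_vector.dim ?V"
      by (intro complex_vector.dim_unique[OF V1 V2, symmetric] independent_orthonormal[OF e finA] refl)
    then show ?thesis unfolding adj card_image[OF inj] unfolding A_def .
  qed
  then have "snumbers X \<sigma>" using comp s by (simp add: snumbers_def)
  then show ?thesis ..
qed

lemma c0star_realized:
  assumes "infinite_dimensional TYPE('h::complex_hilbert)" "\<sigma> \<in> c0star"
  shows "\<exists>X :: 'h \<Rightarrow>\<^sub>L 'h. snumbers X \<sigma>"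
  using ex_orthonormal[OF assms(1)] ex_diagonal_operator[OF _ assms(2)] by blast


section \<open>From ideals to sequences and back\<close>

lemma Sigma_set_subset_c0star: "Sigma_set I \<subseteq> c0star"
  by (auto simp: Sigma_set_def snumbers_def)

text \<open>
  Uniqueness of singular numbers gives one inclusion. The other one needs an operator for each
  sequence, hence a space of infinite dimension.
\<close>
lemma Sigma_set_am_ideal:
  fixes I :: "('h::complex_hilbert \<Rightarrow>\<^sub>L 'h) set"
  assumes inf: "infinite_dimensional TYPE('h)"
  shows "Sigma_set (am_ideal I) = {\<xi> \<in> c0star. \<exists>\<eta>\<in>Sigma_set I. \<xi> \<in> O[principal UNIV](am \<eta>)}"
    (is "_ = ?S")
proof
  show "Sigma_set (am_ideal I) \<subseteq> ?S"
  proof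
    fix \<xi> assume "\<xi> \<in> Sigma_set (am_ideal I)"
    then obtain X where "X \<in> am_ideal I" "snumbers X \<xi>" unfolding Sigma_set_def by blast
    moreover from this obtain \<tau> where "\<tau> \<in> ?S" "snumbers X \<tau>"
      unfolding am_ideal_def calkin_ideal_def by blast
    ultimately have "\<xi> = \<tau>" by (intro snumbers_unique)
    then show "\<xi> \<in> ?S" using \<open>\<tau> \<in> ?S\<close> by (simp only:)
  qed
  show "?S \<subseteq> Sigma_set (am_ideal I)"
  proof
    fix \<xi> assume \<xi>: "\<xi> \<in> ?S"
    then obtain X :: "'h \<Rightarrow>\<^sub>L 'h" where X: "snumbers X \<xi>"
      using c0star_realized[OF inf] by blast
    then have "X \<in> am_ideal I"
      unfolding am_ideal_def calkin_ideal_def using \<xi> by blast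
    then show "\<xi> \<in> Sigma_set (am_ideal I)"
      using X by (auto simp: Sigma_set_def[of "am_ideal I"])
  qed
qed

lemma bigo_am:
  assumes "\<xi> \<in> c0star" "\<zeta> \<in> c0star" "\<xi> \<in> O[principal UNIV](\<zeta>)"
  shows "am \<xi> \<in> O[principal UNIV](am \<zeta>)"
proof -
  note nn = c0starD(2)[OF assms(1)] c0starD(2)[OF assms(2)]
  obtain C where C: "C > 0" "\<And>n. \<xi> n \<le> C * \<zeta> n"
    using assms(3) by (subst (asm) bigo_everywhere_iff) (auto intro: nn)
  have "am \<xi> n \<le> C * am \<zeta> n" for n by (rule am_le_scaled) (rule C(2))
  then show ?thesis using C(1) by (subst bigo_everywhere_iff) (auto intro: nn am_nonneg)
qed

lemma am_am_dominated_if_ideal_subset: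
  fixes I J :: "('h::complex_hilbert \<Rightarrow>\<^sub>L 'h) set"
  assumes inf: "infinite_dimensional TYPE('h)"
    and sub: "am_ideal (am_ideal I) \<subseteq> am_ideal (am_ideal J)" and \<eta>: "\<eta> \<in> Sigma_set I"
  shows "\<exists>\<zeta>\<in>Sigma_set J. am (am \<eta>) \<in> O[principal UNIV](am (am \<zeta>))"
proof -
  have c0: "am \<eta> \<in> c0star" "am (am \<eta>) \<in> c0star"
    using \<eta> Sigma_set_subset_c0star am_in_c0star by blast+
  have "am \<eta> \<in> Sigma_set (am_ideal I)"
    unfolding Sigma_set_am_ideal[OF inf] using c0(1) \<eta> landau_o.big_refl by blast
  then have "am (am \<eta>) \<in> Sigma_set (am_ideal (am_ideal I))"
    unfolding Sigma_set_am_ideal[OF inf, of "am_ideal I"] using c0(2) landau_o.big_refl by blast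
  also have "\<dots> \<subseteq> Sigma_set (am_ideal (am_ideal J))"
    using sub by (auto simp: Sigma_set_def)
  finally obtain \<rho> where \<rho>: "\<rho> \<in> Sigma_set (am_ideal J)" "am (am \<eta>) \<in> O[principal UNIV](am \<rho>)"
    unfolding Sigma_set_am_ideal[OF inf, of "am_ideal J"] by blast
  then obtain \<zeta> where \<zeta>: "\<rho> \<in> c0star" "\<zeta> \<in> Sigma_set J" "\<rho> \<in> O[principal UNIV](am \<zeta>)"
    unfolding Sigma_set_am_ideal[OF inf] by blast
  have "\<zeta> \<in> c0star" using \<zeta>(2) Sigma_set_subset_c0star by blast
  then have "am \<rho> \<in> O[principal UNIV](am (am \<zeta>))"
    using \<zeta> by (intro bigo_am am_in_c0star)
  then show ?thesis using \<rho>(2) \<zeta>(2) bigo_everywhere_trans by blast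
qed

text \<open>
  Both parts of the theorem are instances: in a principal ideal the generator bounds all sequences in
  the mean, because ampliations only cost a constant there, and termwise domination bounds the means
  as well.
\<close>
lemma am_ideal_subset_if_am_am_ideal_subset:
  fixes I J :: "('h::complex_hilbert \<Rightarrow>\<^sub>L 'h) set"
  assumes inf: "infinite_dimensional TYPE('h)"
    and sub: "am_ideal (am_ideal I) \<subseteq> am_ideal (am_ideal J)"
    and dom: "\<And>\<mu>. \<mu> \<in> Sigma_set I \<Longrightarrow>
      \<exists>\<eta>\<in>Sigma_set I. am \<mu> \<in> O[principal UNIV](am \<eta>) \<and> (ratio_asymp_log \<eta> \<or> asymp_hat \<eta>)"
  shows "am_ideal I \<subseteq> am_ideal J"
proof
  fix X assume "X \<in> am_ideal I"
  then obtain \<xi> \<mu> where X: "snumbers X \<xi>" "\<xi> \<in> c0star" "\<mu> \<in> Sigma_set I" "\<xi> \<in> O[principal UNIV](am \<mu>)"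
    unfolding am_ideal_def calkin_ideal_def by blast
  obtain \<eta> where \<eta>: "\<eta> \<in> Sigma_set I" "am \<mu> \<in> O[principal UNIV](am \<eta>)"
      "ratio_asymp_log \<eta> \<or> asymp_hat \<eta>"
    using dom[OF X(3)] by blast
  obtain \<zeta> where \<zeta>: "\<zeta> \<in> Sigma_set J" "am (am \<eta>) \<in> O[principal UNIV](am (am \<zeta>))"
    using am_am_dominated_if_ideal_subset[OF inf sub \<eta>(1)] by blast
  have c0: "\<eta> \<in> c0star" "\<zeta> \<in> c0star" using \<eta>(1) \<zeta>(1) Sigma_set_subset_c0star by blast+
  have "am \<eta> \<in> O[principal UNIV](am \<zeta>)"
    using \<eta>(3) am_cancel_log[OF c0 _ \<zeta>(2)] am_cancel_hat[OF c0 _ \<zeta>(2)] by blast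
  then have "\<xi> \<in> O[principal UNIV](am \<zeta>)"
    using bigo_everywhere_trans[OF X(4) bigo_everywhere_trans[OF \<eta>(2)]] by blast
  then show "X \<in> am_ideal J"
    unfolding am_ideal_def calkin_ideal_def using X \<zeta>(1) by blast
qed

theorem theorem4p6:
  assumes "infinite_dimensional TYPE('h::complex_hilbert)"
    and "separable_space (euclidean :: 'h topology)"
  shows "(\<forall>(I :: ('h \<Rightarrow>\<^sub>L 'h) set) \<eta> J.
            principal_ideal_of I \<eta> \<and> (ratio_asymp_log \<eta> \<or> asymp_hat \<eta>) \<and> op_ideal J \<longrightarrow>
            am_ideal (am_ideal I) \<subseteq> am_ideal (am_ideal J) \<longrightarrow> am_ideal I \<subseteq> am_ideal J) \<and>
         (\<forall>I :: ('h \<Rightarrow>\<^sub>L 'h) set.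
            op_ideal I \<and>
            (\<forall>\<mu>\<in>Sigma_set I. \<exists>\<eta>\<in>Sigma_set I.
               (\<forall>n. \<mu> n \<le> \<eta> n) \<and> (ratio_asymp_log \<eta> \<or> asymp_hat \<eta>)) \<longrightarrow>
            (\<forall>J. op_ideal J \<longrightarrow>
               am_ideal (am_ideal I) \<subseteq> am_ideal (am_ideal J) \<longrightarrow> am_ideal I \<subseteq> am_ideal J))"
proof (intro conjI allI impI, goal_cases)
  case (1 I \<eta> J)
  then have I: "Sigma_set I = {\<xi> \<in> c0star. \<exists>m\<ge>1. \<xi> \<in> O[principal UNIV](ampliation m \<eta>)}"
    and \<eta>: "\<eta> \<in> c0star" and cond: "ratio_asymp_log \<eta> \<or> asymp_hat \<eta>"
    by (auto simp: principal_ideal_of_def)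
  have "ampliation 1 \<eta> = \<eta>" by (auto simp: ampliation_def)
  then have "\<eta> \<in> O[principal UNIV](ampliation 1 \<eta>)" by (simp only: landau_o.big_refl)
  then have mem: "\<eta> \<in> Sigma_set I" unfolding I using \<eta> by blast
  show ?case
  proof (rule am_ideal_subset_if_am_am_ideal_subset[OF assms(1) 1(2)])
    fix \<mu> assume "\<mu> \<in> Sigma_set I"
    then obtain m where \<mu>: "\<mu> \<in> c0star" and m: "m \<ge> 1" "\<mu> \<in> O[principal UNIV](ampliation m \<eta>)"
      unfolding I by blast
    note nn = c0starD(2)[OF \<mu>] c0starD(2)[OF \<eta>]
    have nn_amp: "0 \<le> ampliation m \<eta> n" for n by (simp add: ampliation_def nn)
    obtain C where C: "C > 0" "\<And>n. \<mu> n \<le> C * ampliation m \<eta> n"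
      using m(2) by (subst (asm) bigo_everywhere_iff) (auto intro: nn nn_amp)
    have "am \<mu> n \<le> C * real m * am \<eta> n" for n
    proof -
      have "am \<mu> n \<le> C * am (ampliation m \<eta>) n" by (rule am_le_scaled) (rule C(2))
      also have "\<dots> \<le> C * (real m * am \<eta> n)"
        using C(1) am_ampliation_le[OF \<eta> m(1)] by (intro mult_left_mono) auto
      finally show ?thesis by (simp only: mult.assoc)
    qed
    moreover have "C * real m > 0" using C(1) m(1) by simp
    ultimately have "am \<mu> \<in> O[principal UNIV](am \<eta>)"
      by (subst bigo_everywhere_iff) (auto intro: nn am_nonneg)
    then show "\<exists>\<eta>\<in>Sigma_set I. am \<mu> \<in> O[principal UNIV](am \<eta>) \<and> (ratio_asymp_log \<eta> \<or> asymp_hat \<eta>)"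
      using mem cond by blast
  qed
next
  case (2 I J)
  show ?case
  proof (rule am_ideal_subset_if_am_am_ideal_subset[OF assms(1) 2(3)])
    fix \<mu> assume \<mu>: "\<mu> \<in> Sigma_set I"
    then obtain \<eta> where \<eta>: "\<eta> \<in> Sigma_set I" "\<And>n. \<mu> n \<le> \<eta> n" "ratio_asymp_log \<eta> \<or> asymp_hat \<eta>"
      using 2(1) by blast
    have c0: "\<mu> \<in> c0star" "\<eta> \<in> c0star" using \<mu> \<eta>(1) Sigma_set_subset_c0star by blast+
    have "\<mu> \<in> O[principal UNIV](\<eta>)"
      using \<eta>(2) c0[THEN c0starD(2)]
      by (subst bigo_everywhere_iff) (auto intro!: exI[of _ "1::real"])
    then show "\<exists>\<eta>\<in>Sigma_set I. am \<mu> \<in> O[principal UNIV](am \<eta>) \<and> (ratio_asymp_log \<eta> \<or> asymp_hat \<eta>)"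
      using bigo_am[OF c0] \<eta>(1,3) by blast
  qed
qed

end
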